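(* Let $\mathcal{V}$ be any non-distributive variety of lattices and let $X$ be any set such that $|X|\geq\aleph_2$. Denote by $\mathbf{B}_{\mathcal{V}}(X)$ the free product in $\mathcal{V}$ of $X$ copies of a two-element chain, with a least and a largest element added (that is, the bounded lattice in $\mathcal{V}$ freely generated by chains $s_i<t_i$, for $i\in X$). Then the $\langle\vee,0\rangle$-semilattice $\mathrm{Con_c}\,\mathbf{B}_{\mathcal{V}}(X)$ does not satisfy $\mathrm{WURP}^{=}(\mathbf{1})$, where $\mathbf{1}$ denotes the largest element of $\mathrm{Con_c}\,\mathbf{B}_{\mathcal{V}}(X)$.
   Context: For an algebra $A$, $\mathrm{Con_c}\,A$ denotes the $\langle\vee,0\rangle$-semilattice of all compact (i.e., finitely generated) congruences of $A$. A variety of lattices is non-distributive if it contains a non-distributive lattice. Let $e$ be an element of a $\langle\vee,0\rangle$-semilattice $S$. We say that $S$ satisfies $\mathrm{WURP}^{=}(e)$ if there exists a positive integer $m$ such that for all families $(a_i)_{i\in I}$ and $(b_i)_{i\in I}$ of elements of $S$ (with the same index set $I$) such that $e\leq a_i\vee b_i$ for all $i\in I$, there are subsets $I_u$ ($0\leq u<m$) of $I$ with $\bigcup_{u<m}I_u=I$ and a family $(c_{i,j})_{(i,j)\in I\times I}$ of elements of $S$ such that: (i) $c_{i,j}\leq a_i\vee a_j$ and $c_{i,j}\leq b_i\vee b_j$, for all $u<m$ and all $i,j\in I_u$; (ii) $e\leq a_j\vee b_i\vee c_{i,j}$, for all $u<m$ and all $i,j\in I_u$; (iii) $c_{i,k}\leq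 c_{i,j}\vee c_{j,k}$, for all $i,j,k\in I$. *)

theory Defs
  imports "HOL-Algebra.Lattice"
begin

unbundle cardinal_syntax

datatype 'v lterm = Gen 'v | Join "'v lterm" "'v lterm" | Meet "'v lterm" "'v lterm"

primrec lterm_eval :: "('a, 'm) gorder_scheme \<Rightarrow> ('v \<Rightarrow> 'a) \<Rightarrow> 'v lterm \<Rightarrow> 'a" where
  "lterm_eval L \<rho> (Gen v) = \<rho> v"
| "lterm_eval L \<rho> (Join p q) = lterm_eval L \<rho> p \<squnion>\<^bsub>L\<^esub> lterm_eval L \<rho> q"
| "lterm_eval L \<rho> (Meet p q) = lterm_eval L \<rho> p \<sqinter>\<^bsub>L\<^esub> lterm_eval L \<rho> q"

primrec lterm_subst :: "('v \<Rightarrow> 'w lterm) \<Rightarrow> 'v lterm \<Rightarrow> 'w lterm" where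
  "lterm_subst \<sigma> (Gen v) = \<sigma> v"
| "lterm_subst \<sigma> (Join p q) = Join (lterm_subst \<sigma> p) (lterm_subst \<sigma> q)"
| "lterm_subst \<sigma> (Meet p q) = Meet (lterm_subst \<sigma> p) (lterm_subst \<sigma> q)"

text \<open>
  A variety of lattices is represented by a set \<open>E\<close> of lattice identities in countably many
  variables; its members are the lattices, on carriers of arbitrary types, that satisfy
  all identities of \<open>E\<close>. That it contains a lattice with a given property is expressed by
  an assumption on a lattice \<open>L\<close> of arbitrary carrier type.
\<close>

type_synonym lidentities = "(nat lterm \<times> nat lterm) set"

definition in_variety :: "lidentities \<Rightarrow> ('a, 'm) gorder_scheme \<Rightarrow> bool" where
  "in_variety E L \<longleftrightarrow> lattice L \<and>
     (\<forall>(l, r)\<in>E. \<forall>\<rho>. range \<rho> \<subseteq> carrier L \<longrightarrow> lterm_eval L \<rho> l = lterm_eval L \<rho> r)"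

definition distributive :: "('a, 'm) gorder_scheme \<Rightarrow> bool" where
  "distributive L \<longleftrightarrow> (\<forall>x\<in>carrier L. \<forall>y\<in>carrier L. \<forall>z\<in>carrier L.
     x \<sqinter>\<^bsub>L\<^esub> (y \<squnion>\<^bsub>L\<^esub> z) = (x \<sqinter>\<^bsub>L\<^esub> y) \<squnion>\<^bsub>L\<^esub> (x \<sqinter>\<^bsub>L\<^esub> z))"


section \<open>Free products in a variety\<close>

text \<open>
  The free product in the variety of \<open>E\<close> of a family \<open>(L i)\<close> of lattices, \<open>i \<in> X\<close>, is
  presented by the generators \<open>(i, a)\<close>, \<open>a \<in> carrier (L i)\<close>, and the relations that make
  every map \<open>a \<mapsto> (i, a)\<close> a lattice homomorphism. Its elements are the classes of
  the least congruence on the terms that contains these relations, the lattice axioms and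
  all instances of \<open>E\<close>.
\<close>

definition fp_terms :: "'i set \<Rightarrow> ('i \<Rightarrow> ('a, 'm) gorder_scheme) \<Rightarrow> ('i \<times> 'a) lterm set" where
  "fp_terms X L = {p. set_lterm p \<subseteq> (SIGMA i:X. carrier (L i))}"

inductive fp_eq :: "lidentities \<Rightarrow> 'i set \<Rightarrow> ('i \<Rightarrow> ('a, 'm) gorder_scheme)
    \<Rightarrow> ('i \<times> 'a) lterm \<Rightarrow> ('i \<times> 'a) lterm \<Rightarrow> bool"
  for E X L where
  fp_refl: "p \<in> fp_terms X L \<Longrightarrow> fp_eq E X L p p"
| fp_sym: "fp_eq E X L p q \<Longrightarrow> fp_eq E X L q p"
| fp_trans: "fp_eq E X L p q \<Longrightarrow> fp_eq E X L q r \<Longrightarrow> fp_eq E X L p r"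
| fp_join_cong: "fp_eq E X L p p' \<Longrightarrow> fp_eq E X L q q' \<Longrightarrow> fp_eq E X L (Join p q) (Join p' q')"
| fp_meet_cong: "fp_eq E X L p p' \<Longrightarrow> fp_eq E X L q q' \<Longrightarrow> fp_eq E X L (Meet p q) (Meet p' q')"
| fp_join_comm: "p \<in> fp_terms X L \<Longrightarrow> q \<in> fp_terms X L \<Longrightarrow> fp_eq E X L (Join p q) (Join q p)"
| fp_meet_comm: "p \<in> fp_terms X L \<Longrightarrow> q \<in> fp_terms X L \<Longrightarrow> fp_eq E X L (Meet p q) (Meet q p)"
| fp_join_assoc: "p \<in> fp_terms X L \<Longrightarrow> q \<in> fp_terms X L \<Longrightarrow> r \<in> fp_terms X L \<Longrightarrow>
    fp_eq E X L (Join (Join p q) r) (Join p (Join q r))"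
| fp_meet_assoc: "p \<in> fp_terms X L \<Longrightarrow> q \<in> fp_terms X L \<Longrightarrow> r \<in> fp_terms X L \<Longrightarrow>
    fp_eq E X L (Meet (Meet p q) r) (Meet p (Meet q r))"
| fp_join_absorb: "p \<in> fp_terms X L \<Longrightarrow> q \<in> fp_terms X L \<Longrightarrow> fp_eq E X L (Join p (Meet p q)) p"
| fp_meet_absorb: "p \<in> fp_terms X L \<Longrightarrow> q \<in> fp_terms X L \<Longrightarrow> fp_eq E X L (Meet p (Join p q)) p"
| fp_ident: "(l, r) \<in> E \<Longrightarrow> range \<sigma> \<subseteq> fp_terms X L \<Longrightarrow>
    fp_eq E X L (lterm_subst \<sigma> l) (lterm_subst \<sigma> r)"
| fp_gen_join: "i \<in> X \<Longrightarrow> a \<in> carrier (L i) \<Longrightarrow> b \<in> carrier (L i) \<Longrightarrow>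
    fp_eq E X L (Join (Gen (i, a)) (Gen (i, b))) (Gen (i, a \<squnion>\<^bsub>L i\<^esub> b))"
| fp_gen_meet: "i \<in> X \<Longrightarrow> a \<in> carrier (L i) \<Longrightarrow> b \<in> carrier (L i) \<Longrightarrow>
    fp_eq E X L (Meet (Gen (i, a)) (Gen (i, b))) (Gen (i, a \<sqinter>\<^bsub>L i\<^esub> b))"

definition free_product :: "lidentities \<Rightarrow> 'i set \<Rightarrow> ('i \<Rightarrow> ('a, 'm) gorder_scheme)
    \<Rightarrow> ('i \<times> 'a) lterm set gorder" where
  "free_product E X L =
     \<lparr>carrier = fp_terms X L // {(p, q). fp_eq E X L p q},
      eq = (=),
      le = (\<lambda>P Q. \<exists>p\<in>P. \<exists>q\<in>Q. fp_eq E X L (Join p q) q)\<rparr>"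


section \<open>The lattice freely generated by chains of length two\<close>

text \<open>A new least and a new largest element are adjoined, whether or not there was one before.\<close>

datatype 'a bounded = Zero | Elem 'a | One

fun bounded_le :: "('a \<Rightarrow> 'a \<Rightarrow> bool) \<Rightarrow> 'a bounded \<Rightarrow> 'a bounded \<Rightarrow> bool" where
  "bounded_le r Zero y = True"
| "bounded_le r x One = True"
| "bounded_le r (Elem x) (Elem y) = r x y"
| "bounded_le r x y = False"

definition add_bounds :: "('a, 'm) gorder_scheme \<Rightarrow> 'a bounded gorder" where
  "add_bounds L = \<lparr>carrier = {Zero, One} \<union> Elem ` carrier L, eq = (=), le = bounded_le (le L)\<rparr>"

definition two_chain :: "bool gorder" where
  "two_chain = \<lparr>carrier = UNIV, eq = (=), le = (\<le>)\<rparr>"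

text \<open>The generators \<open>s\<^sub>i < t\<^sub>i\<close> are the classes of \<open>Gen (i, False)\<close> and \<open>Gen (i, True)\<close>.\<close>

definition B_lattice :: "lidentities \<Rightarrow> 'x set \<Rightarrow> ('x \<times> bool) lterm set bounded gorder" where
  "B_lattice E X = add_bounds (free_product E X (\<lambda>_. two_chain))"


section \<open>Compact congruences\<close>

definition congruence :: "('a, 'm) gorder_scheme \<Rightarrow> ('a \<times> 'a) set \<Rightarrow> bool" where
  "congruence L \<theta> \<longleftrightarrow> equiv (carrier L) \<theta> \<and>
     (\<forall>(x, x')\<in>\<theta>. \<forall>(y, y')\<in>\<theta>. (x \<squnion>\<^bsub>L\<^esub> y, x' \<squnion>\<^bsub>L\<^esub> y') \<in> \<theta> \<and> (x \<sqinter>\<^bsub>L\<^esub> y, x' \<sqinter>\<^bsub>L\<^esub> y') \<in> \<theta>)"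

definition cong_generated :: "('a, 'm) gorder_scheme \<Rightarrow> ('a \<times> 'a) set \<Rightarrow> ('a \<times> 'a) set" where
  "cong_generated L A = \<Inter>{\<theta>. congruence L \<theta> \<and> A \<subseteq> \<theta>}"

definition Con_c :: "('a, 'm) gorder_scheme \<Rightarrow> ('a \<times> 'a) set gorder" where
  "Con_c L = \<lparr>carrier = {cong_generated L A | A. finite A \<and> A \<subseteq> carrier L \<times> carrier L},
              eq = (=), le = (\<subseteq>)\<rparr>"


section \<open>The uniform refinement property\<close>

text \<open>The clauses (i)--(iii) for a given number \<open>m\<close> and given families indexed by \<open>I\<close>.\<close>

definition WURP_refines ::
  "('s, 'm) gorder_scheme \<Rightarrow> 's \<Rightarrow> nat \<Rightarrow> 'i set \<Rightarrow> ('i \<Rightarrow> 's) \<Rightarrow> ('i \<Rightarrow> 's) \<Rightarrow> bool" where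
  "WURP_refines S e m I a b \<longleftrightarrow>
     (\<exists>(J :: nat \<Rightarrow> 'i set) (c :: 'i \<Rightarrow> 'i \<Rightarrow> 's).
        (\<forall>u<m. J u \<subseteq> I) \<and> (\<Union>u<m. J u) = I \<and>
        (\<forall>i\<in>I. \<forall>j\<in>I. c i j \<in> carrier S) \<and>
        (\<forall>u<m. \<forall>i\<in>J u. \<forall>j\<in>J u.
           c i j \<sqsubseteq>\<^bsub>S\<^esub> a i \<squnion>\<^bsub>S\<^esub> a j \<and> c i j \<sqsubseteq>\<^bsub>S\<^esub> b i \<squnion>\<^bsub>S\<^esub> b j) \<and>
        (\<forall>u<m. \<forall>i\<in>J u. \<forall>j\<in>J u. e \<sqsubseteq>\<^bsub>S\<^esub> (a j \<squnion>\<^bsub>S\<^esub> b i) \<squnion>\<^bsub>S\<^esub> c i j) \<and>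
        (\<forall>i\<in>I. \<forall>j\<in>I. \<forall>k\<in>I. c i k \<sqsubseteq>\<^bsub>S\<^esub> c i j \<squnion>\<^bsub>S\<^esub> c j k))"

text \<open>
  HOL cannot quantify over index sets of all types within a definition. Index sets of pairs
  of elements suffice, since the clauses depend on an index \<open>i\<close> only through the
  pair \<open>(a i, b i)\<close>; the lemma below states this for an arbitrary index type.
\<close>

definition WURP_eq :: "('s, 'm) gorder_scheme \<Rightarrow> 's \<Rightarrow> bool" where
  "WURP_eq S e \<longleftrightarrow> (\<exists>m>0. \<forall>(I :: ('s \<times> 's) set) a b.
     a ` I \<subseteq> carrier S \<longrightarrow> b ` I \<subseteq> carrier S \<longrightarrow> (\<forall>i\<in>I. e \<sqsubseteq>\<^bsub>S\<^esub> a i \<squnion>\<^bsub>S\<^esub> b i) \<longrightarrow>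
     WURP_refines S e m I a b)"

lemma WURP_eq_any_index:
  assumes "WURP_eq S e"
  shows "\<exists>m>0. \<forall>(I :: 'i set) a b.
     a ` I \<subseteq> carrier S \<longrightarrow> b ` I \<subseteq> carrier S \<longrightarrow> (\<forall>i\<in>I. e \<sqsubseteq>\<^bsub>S\<^esub> a i \<squnion>\<^bsub>S\<^esub> b i) \<longrightarrow>
     WURP_refines S e m I a b"
proof -
  from assms obtain m where m: "m > 0"
    and W: "\<And>(I :: ('a \<times> 'a) set) a b. a ` I \<subseteq> carrier S \<Longrightarrow> b ` I \<subseteq> carrier S \<Longrightarrow>
      (\<forall>i\<in>I. e \<sqsubseteq>\<^bsub>S\<^esub> a i \<squnion>\<^bsub>S\<^esub> b i) \<Longrightarrow> WURP_refines S e m I a b"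
    unfolding WURP_eq_def by blast
  have "WURP_refines S e m I a b"
    if "a ` I \<subseteq> carrier S" "b ` I \<subseteq> carrier S" "\<forall>i\<in>I. e \<sqsubseteq>\<^bsub>S\<^esub> a i \<squnion>\<^bsub>S\<^esub> b i"
    for I :: "'i set" and a b
  proof -
    define f where "f i = (a i, b i)" for i
    have "WURP_refines S e m (f ` I) fst snd"
      using that by (intro W) (auto simp: f_def)
    then obtain J :: "nat \<Rightarrow> ('a \<times> 'a) set" and c where
      J: "\<forall>u<m. J u \<subseteq> f ` I" "(\<Union>u<m. J u) = f ` I"
      and c: "\<forall>i\<in>f ` I. \<forall>j\<in>f ` I. c i j \<in> carrier S"
      and i: "\<forall>u<m. \<forall>i\<in>J u. \<forall>j\<in>J u. c i j \<sqsubseteq>\<^bsub>S\<^esub> fst i \<squnion>\<^bsub>S\<^esub> fst j \<and> c i j \<sqsubseteq>\<^bsub>S\<^esub> snd i \<squnion>\<^bsub>S\<^esub> snd j"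
      and ii: "\<forall>u<m. \<forall>i\<in>J u. \<forall>j\<in>J u. e \<sqsubseteq>\<^bsub>S\<^esub> (fst j \<squnion>\<^bsub>S\<^esub> snd i) \<squnion>\<^bsub>S\<^esub> c i j"
      and iii: "\<forall>i\<in>f ` I. \<forall>j\<in>f ` I. \<forall>k\<in>f ` I. c i k \<sqsubseteq>\<^bsub>S\<^esub> c i j \<squnion>\<^bsub>S\<^esub> c j k"
      unfolding WURP_refines_def by (elim exE conjE) (rule that)
    show ?thesis
      unfolding WURP_refines_def
    proof (intro exI[of _ "\<lambda>u. {i\<in>I. f i \<in> J u}"] exI[of _ "\<lambda>i j. c (f i) (f j)"] conjI)
      show "\<forall>u<m. {i\<in>I. f i \<in> J u} \<subseteq> I"
        by blast
      show "(\<Union>u<m. {i\<in>I. f i \<in> J u}) = I"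
        using J(2) by blast
      show "\<forall>i\<in>I. \<forall>j\<in>I. c (f i) (f j) \<in> carrier S"
        using c by blast
      show "\<forall>u<m. \<forall>i\<in>{i\<in>I. f i \<in> J u}. \<forall>j\<in>{i\<in>I. f i \<in> J u}.
          c (f i) (f j) \<sqsubseteq>\<^bsub>S\<^esub> a i \<squnion>\<^bsub>S\<^esub> a j \<and> c (f i) (f j) \<sqsubseteq>\<^bsub>S\<^esub> b i \<squnion>\<^bsub>S\<^esub> b j"
      proof (intro allI impI ballI)
        fix u i j assume "u < m" "i \<in> {i\<in>I. f i \<in> J u}" "j \<in> {i\<in>I. f i \<in> J u}"
        with i[rule_format, of u "f i" "f j"]
        show "c (f i) (f j) \<sqsubseteq>\<^bsub>S\<^esub> a i \<squnion>\<^bsub>S\<^esub> a j \<and> c (f i) (f j) \<sqsubseteq>\<^bsub>S\<^esub> b i \<squnion>\<^bsub>S\<^esub> b j"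
          by (simp add: f_def)
      qed
      show "\<forall>u<m. \<forall>i\<in>{i\<in>I. f i \<in> J u}. \<forall>j\<in>{i\<in>I. f i \<in> J u}.
          e \<sqsubseteq>\<^bsub>S\<^esub> (a j \<squnion>\<^bsub>S\<^esub> b i) \<squnion>\<^bsub>S\<^esub> c (f i) (f j)"
      proof (intro allI impI ballI)
        fix u i j assume "u < m" "i \<in> {i\<in>I. f i \<in> J u}" "j \<in> {i\<in>I. f i \<in> J u}"
        with ii[rule_format, of u "f i" "f j"]
        show "e \<sqsubseteq>\<^bsub>S\<^esub> (a j \<squnion>\<^bsub>S\<^esub> b i) \<squnion>\<^bsub>S\<^esub> c (f i) (f j)"
          by (simp add: f_def)
      qed
      show "\<forall>i\<in>I. \<forall>j\<in>I. \<forall>k\<in>I. c (f i) (f k) \<sqsubseteq>\<^bsub>S\<^esub> c (f i) (f j) \<squnion>\<^bsub>S\<^esub> c (f j) (f k)"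
        using iii by blast
    qed
  qed
  with m show ?thesis by (intro exI[of _ m] conjI allI impI)
qed

end

theory Submission
  imports Defs
begin

text \<open>
  A non-distributive member \<open>L\<close> of the variety contains an element \<open>q\<close> with two distinct
  complements \<open>p\<close> and \<open>r\<close> in an interval \<open>[z, u]\<close>, and one may assume that \<open>p \<sqsubseteq> r\<close> fails
  (\<open>nondistributive_two_complements\<close>). Everything is derived from homomorphisms of the free
  lattice to \<open>L\<close> and to the two-element chain.

  The uniform refinement property fails for the families
  \<open>a\<^sub>i = \<Theta>(0, s\<^sub>i) \<or> \<Theta>(t\<^sub>i, 1)\<close> and \<open>b\<^sub>i = \<Theta>(s\<^sub>i, t\<^sub>i)\<close>, called \<open>outer_cong\<close> and
  \<open>inner_cong\<close> below. Suppose that they have refinements \<open>c\<^sub>i\<^sub>j\<close>. Each \<open>c\<^sub>i\<^sub>j\<close> is generated by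
  finitely many pairs, and these involve only the chains with index in a finite set \<open>F i j\<close>. One
  of the finitely many parts of the index set has at least \<open>\<aleph>\<^sub>2\<close> elements, and Kuratowski's
  free set theorem (\<open>free_triple\<close>) gives distinct \<open>i\<close>, \<open>j\<close>, \<open>k\<close> in it, none of which lies
  in the support that belongs to the other two.

  Now map \<open>(s, t)\<close> to \<open>(p, u)\<close> at \<open>i\<close>, to \<open>(z, q)\<close> at \<open>j\<close>, to \<open>(r, u)\<close> at \<open>k\<close> and to
  \<open>(z, z)\<close> elsewhere. On the support of \<open>c\<^sub>i\<^sub>j\<close> the chain at \<open>k\<close> is invisible, so that the
  image is in the square \<open>{z, p, q, u}\<close>, a distributive lattice. In its congruence lattice the
  images of \<open>a\<^sub>i\<close> and \<open>a\<^sub>j\<close> coincide, those of \<open>b\<^sub>i\<close> and \<open>b\<^sub>j\<close> coincide, and they meet in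
  zero; therefore \<open>c\<^sub>i\<^sub>j\<close>, which is below \<open>a\<^sub>i \<or> a\<^sub>j\<close> and below \<open>b\<^sub>i \<or> b\<^sub>j\<close>, is killed
  (\<open>square_kernel\<close>). The same argument with \<open>r\<close> in place of \<open>p\<close> kills \<open>c\<^sub>j\<^sub>k\<close>, and
  \<open>c\<^sub>i\<^sub>k \<le> c\<^sub>i\<^sub>j \<or> c\<^sub>j\<^sub>k\<close> is killed as well. On the support of \<open>c\<^sub>i\<^sub>k\<close>, however, the chain at
  \<open>j\<close> is invisible and all values lie above \<open>p\<close> or below \<open>r\<close>. Separating the two cases
  defines a homomorphism to the two-element chain that kills \<open>c\<^sub>i\<^sub>k\<close>, \<open>a\<^sub>k\<close> and \<open>b\<^sub>i\<close>,
  although the join of these congruences is the largest one (\<open>no_refinement_on_free_triple\<close>).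
\<close>

section \<open>Relative complements in non-distributive lattices\<close>

lemma (in partial_order) join_eqI:
  assumes "x \<in> carrier L" "y \<in> carrier L" "s \<in> carrier L" "x \<sqsubseteq> s" "y \<sqsubseteq> s"
    and "\<And>u. u \<in> carrier L \<Longrightarrow> x \<sqsubseteq> u \<Longrightarrow> y \<sqsubseteq> u \<Longrightarrow> s \<sqsubseteq> u"
  shows "x \<squnion> y = s"
proof -
  have "least L s (Upper L {x, y})"
    using assms by (intro least_UpperI) (auto simp: Upper_def)
  then show ?thesis
    unfolding join_def sup_def by (metis least_unique someI_ex)
qed

lemma (in partial_order) meet_eqI:
  assumes "x \<in> carrier L" "y \<in> carrier L" "s \<in> carrier L" "s \<sqsubseteq> x" "s \<sqsubseteq> y"
    and "\<And>u. u \<in> carrier L \<Longrightarrow> u \<sqsubseteq> x \<Longrightarrow> u \<sqsubseteq> y \<Longrightarrow> u \<sqsubseteq> s"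
  shows "x \<sqinter> y = s"
proof -
  have "greatest L s (Lower L {x, y})"
    using assms by (intro greatest_LowerI) (auto simp: Lower_def)
  then show ?thesis
    unfolding meet_def inf_def by (metis greatest_unique someI_ex)
qed

text \<open>
  Relative complements are unique: no element has two distinct complements in an interval.
\<close>

definition cancellative :: "('a, 'm) gorder_scheme \<Rightarrow> bool" where
  "cancellative L \<longleftrightarrow> (\<forall>p\<in>carrier L. \<forall>q\<in>carrier L. \<forall>r\<in>carrier L.
     p \<sqinter>\<^bsub>L\<^esub> q = r \<sqinter>\<^bsub>L\<^esub> q \<longrightarrow> p \<squnion>\<^bsub>L\<^esub> q = r \<squnion>\<^bsub>L\<^esub> q \<longrightarrow> p = r)"

definition modular :: "('a, 'm) gorder_scheme \<Rightarrow> bool" where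
  "modular L \<longleftrightarrow> (\<forall>x\<in>carrier L. \<forall>y\<in>carrier L. \<forall>z\<in>carrier L.
     x \<sqsubseteq>\<^bsub>L\<^esub> z \<longrightarrow> x \<squnion>\<^bsub>L\<^esub> (y \<sqinter>\<^bsub>L\<^esub> z) = (x \<squnion>\<^bsub>L\<^esub> y) \<sqinter>\<^bsub>L\<^esub> z)"

context lattice
begin

lemma join_mono:
  assumes "x \<sqsubseteq> x'" "y \<sqsubseteq> y'" "x \<in> carrier L" "y \<in> carrier L" "x' \<in> carrier L" "y' \<in> carrier L"
  shows "x \<squnion> y \<sqsubseteq> x' \<squnion> y'"
  using assms by (meson join_closed join_le join_left join_right le_trans)

lemma meet_mono:
  assumes "x \<sqsubseteq> x'" "y \<sqsubseteq> y'" "x \<in> carrier L" "y \<in> carrier L" "x' \<in> carrier L" "y' \<in> carrier L"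
  shows "x \<sqinter> y \<sqsubseteq> x' \<sqinter> y'"
  using assms by (meson meet_closed meet_le meet_left meet_right le_trans)

lemma join_absorb2: "x \<sqsubseteq> y \<Longrightarrow> x \<in> carrier L \<Longrightarrow> y \<in> carrier L \<Longrightarrow> x \<squnion> y = y"
  by (rule join_eqI) auto

lemma meet_absorb1: "x \<sqsubseteq> y \<Longrightarrow> x \<in> carrier L \<Longrightarrow> y \<in> carrier L \<Longrightarrow> x \<sqinter> y = x"
  by (rule meet_eqI) auto

lemma cancellative_imp_modular:
  assumes C: "cancellative L"
  shows "modular L"
  unfolding modular_def
proof (intro ballI impI)
  fix x y z assume [simp]: "x \<in> carrier L" "y \<in> carrier L" "z \<in> carrier L" and xz: "x \<sqsubseteq> z"
  let ?r = "x \<squnion> (y \<sqinter> z)" and ?p = "(x \<squnion> y) \<sqinter> z"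
  have rp: "?r \<sqsubseteq> ?p"
    by (intro join_le meet_le join_mono) (auto simp: xz meet_left meet_right join_left
        intro: le_trans[OF meet_left join_right])
  have ry: "y \<sqinter> z \<sqsubseteq> ?r" "x \<sqsubseteq> ?r"
    by (auto intro: join_left join_right)
  have py: "?p \<sqsubseteq> z" "?p \<sqsubseteq> x \<squnion> y"
    by (auto intro: meet_left meet_right)
  have "?r \<sqinter> y = y \<sqinter> z"
  proof (rule meet_eqI)
    fix u assume u: "u \<in> carrier L" "u \<sqsubseteq> ?r" "u \<sqsubseteq> y"
    then have "u \<sqsubseteq> z" using rp py by (meson join_closed le_trans meet_closed \<open>x \<in> _\<close> \<open>y \<in> _\<close> \<open>z \<in> _\<close>)
    with u show "u \<sqsubseteq> y \<sqinter> z" by (auto intro: meet_le)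
  qed (auto intro: ry meet_left)
  moreover have "?p \<sqinter> y = y \<sqinter> z"
  proof (rule meet_eqI)
    fix u assume u: "u \<in> carrier L" "u \<sqsubseteq> ?p" "u \<sqsubseteq> y"
    then have "u \<sqsubseteq> z" using py by (meson join_closed le_trans meet_closed \<open>x \<in> _\<close> \<open>y \<in> _\<close> \<open>z \<in> _\<close>)
    with u show "u \<sqsubseteq> y \<sqinter> z" by (auto intro: meet_le)
  next
    show "y \<sqinter> z \<sqsubseteq> ?p" by (rule le_trans[OF ry(1) rp]) auto
  qed (auto intro: meet_left)
  moreover have "?r \<squnion> y = x \<squnion> y"
  proof (rule join_eqI)
    fix u assume u: "u \<in> carrier L" "?r \<sqsubseteq> u" "y \<sqsubseteq> u"
    then have "x \<sqsubseteq> u" using ry by (meson join_closed le_trans meet_closed \<open>x \<in> _\<close> \<open>y \<in> _\<close> \<open>z \<in> _\<close>)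
    with u show "x \<squnion> y \<sqsubseteq> u" by (auto intro: join_le)
  next
    show "?r \<sqsubseteq> x \<squnion> y" by (rule le_trans[OF rp py(2)]) auto
  qed (auto intro: join_right)
  moreover have "?p \<squnion> y = x \<squnion> y"
  proof (rule join_eqI)
    fix u assume u: "u \<in> carrier L" "?p \<sqsubseteq> u" "y \<sqsubseteq> u"
    then have "x \<sqsubseteq> u" using ry rp by (meson join_closed le_trans meet_closed \<open>x \<in> _\<close> \<open>y \<in> _\<close> \<open>z \<in> _\<close>)
    with u show "x \<squnion> y \<sqsubseteq> u" by (auto intro: join_le)
  qed (auto intro: join_right py)
  ultimately show "?r = ?p"
    using C unfolding cancellative_def by (metis (no_types) join_closed meet_closed \<open>x \<in> _\<close> \<open>y \<in> _\<close> \<open>z \<in> _\<close>)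
qed

lemma modularD:
  "modular L \<Longrightarrow> x \<sqsubseteq> z \<Longrightarrow> x \<in> carrier L \<Longrightarrow> y \<in> carrier L \<Longrightarrow> z \<in> carrier L
    \<Longrightarrow> x \<squnion> (y \<sqinter> z) = (x \<squnion> y) \<sqinter> z"
  unfolding modular_def by blast

text \<open>
  With \<open>d\<close> and \<open>e\<close> the lower and the upper median of \<open>x\<close>, \<open>y\<close>, \<open>z\<close>, the elements
  \<open>d \<squnion> (w \<sqinter> e)\<close> for \<open>w = x, y, z\<close> form the middle layer of the diamond that witnesses
  non-distributivity of a modular lattice. Only those inequalities about the medians are assumed
  that a meet of two middle elements requires, so that the dual statement gives the joins.
\<close>

lemma modular_diamond_meet:
  assumes M: "modular L"
    and [simp]: "x \<in> carrier L" "y \<in> carrier L" "z \<in> carrier L" "d \<in> carrier L" "e \<in> carrier L"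
    and "d \<sqsubseteq> e" "x \<sqinter> y \<sqsubseteq> d" "x \<sqinter> z \<sqsubseteq> d"
    and xe: "x \<sqinter> e \<sqsubseteq> x \<sqinter> (y \<squnion> z)" and yd: "y \<squnion> d \<sqsubseteq> y \<squnion> (x \<sqinter> z)"
  shows "(d \<squnion> (x \<sqinter> e)) \<sqinter> (d \<squnion> (y \<sqinter> e)) = d"
proof -
  let ?v = "d \<squnion> (y \<sqinter> e)"
  have v: "?v \<sqsubseteq> y \<squnion> d"
    by (intro join_le) (auto intro: join_right le_trans[OF meet_left join_left])
  \<comment> \<open>By modularity it suffices to bound the part of the meet that lies below \<open>x \<sqinter> e\<close>.\<close>
  have "(x \<sqinter> e) \<sqinter> ?v \<sqsubseteq> x \<sqinter> (y \<squnion> (x \<sqinter> z))"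
    by (intro meet_mono le_trans[OF v yd]) (auto intro: meet_left)
  also have "x \<sqinter> (y \<squnion> (x \<sqinter> z)) = (x \<sqinter> z) \<squnion> (y \<sqinter> x)"
    using modularD[OF M, of "x \<sqinter> z" x y] by (simp add: meet_left join_comm meet_comm)
  also have "\<dots> \<sqsubseteq> d"
    using assms by (intro join_le) (auto simp: meet_comm)
  finally have "(x \<sqinter> e) \<sqinter> ?v \<sqsubseteq> d" by auto
  moreover have "d \<squnion> ((x \<sqinter> e) \<sqinter> ?v) = (d \<squnion> (x \<sqinter> e)) \<sqinter> ?v"
    by (rule modularD[OF M]) (auto intro: join_left)
  ultimately show ?thesis
    by (metis join_absorb2 join_comm meet_closed join_closed assms(2-6))
qed

end

lemma modular_dual: "lattice L \<Longrightarrow> modular L \<Longrightarrow> modular (inv_gorder L)"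
  unfolding modular_def by (simp add: join_comm meet_comm) (metis join_comm meet_comm)

text \<open>
  By modularity the upper and the lower median \<open>e\<close> and \<open>d\<close> of three elements bound a diamond
  with middle elements \<open>m x\<close>, \<open>m y\<close>, \<open>m z\<close>. Both \<open>m x\<close> and \<open>m y\<close> are complements of \<open>m z\<close>
  between \<open>d\<close> and \<open>e\<close>, so the diamond collapses to \<open>d = e\<close>; below \<open>x\<close> this is the
  distributive law.
\<close>

lemma (in lattice) cancellative_imp_distributive:
  assumes C: "cancellative L"
  shows "distributive L"
  unfolding distributive_def
proof (intro ballI)
  fix x y z assume [simp]: "x \<in> carrier L" "y \<in> carrier L" "z \<in> carrier L"
  have M: "modular L" by (rule cancellative_imp_modular[OF C])
  interpret D: lattice "inv_gorder L" by (rule dual_lattice)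
  have MD: "modular (inv_gorder L)" by (rule modular_dual[OF _ M]) unfold_locales
  define d where "d = (x \<sqinter> y) \<squnion> ((y \<sqinter> z) \<squnion> (x \<sqinter> z))"
  define e where "e = (x \<squnion> y) \<sqinter> ((y \<squnion> z) \<sqinter> (x \<squnion> z))"
  have [simp]: "d \<in> carrier L" "e \<in> carrier L" by (auto simp: d_def e_def)
  have d: "x \<sqinter> y \<sqsubseteq> d" "y \<sqinter> z \<sqsubseteq> d" "x \<sqinter> z \<sqsubseteq> d"
    unfolding d_def by (auto intro: join_left join_right le_trans[OF join_left join_right] le_trans[OF join_right join_right])
  have e: "e \<sqsubseteq> x \<squnion> y" "e \<sqsubseteq> y \<squnion> z" "e \<sqsubseteq> x \<squnion> z"
    unfolding e_def by (auto intro: meet_left meet_right le_trans[OF meet_right meet_left] le_trans[OF meet_right meet_right])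
  have de: "d \<sqsubseteq> e"
    unfolding d_def e_def
    by (intro join_le meet_le)
       (auto intro: le_trans[OF meet_left join_left] le_trans[OF meet_left join_right]
          le_trans[OF meet_right join_left] le_trans[OF meet_right join_right])
  define m where "m w = d \<squnion> (w \<sqinter> e)" for w
  have m[simp]: "w \<in> carrier L \<Longrightarrow> m w \<in> carrier L" for w by (simp add: m_def)
  \<comment> \<open>The selfdual form of the middle elements, through which the joins follow from the meets.\<close>
  have m': "m w = e \<sqinter> (w \<squnion> d)" if "w \<in> carrier L" for w
    unfolding m_def using modularD[OF M de _ that] by (simp add: that join_comm meet_comm)
  have xd: "x \<squnion> d \<sqsubseteq> x \<squnion> (y \<sqinter> z)" "y \<squnion> d \<sqsubseteq> y \<squnion> (x \<sqinter> z)" "z \<squnion> d \<sqsubseteq> z \<squnion> (x \<sqinter> y)"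
    unfolding d_def by (auto intro!: join_le intro: join_left join_right le_trans[OF meet_left join_left]
        le_trans[OF meet_right join_left])
  have xe: "x \<sqinter> (y \<squnion> z) \<sqsubseteq> x \<sqinter> e" "y \<sqinter> (x \<squnion> z) \<sqsubseteq> y \<sqinter> e" "z \<sqinter> (x \<squnion> y) \<sqsubseteq> z \<sqinter> e"
    unfolding e_def by (auto intro!: meet_le intro: meet_left meet_right le_trans[OF meet_left join_left]
        le_trans[OF meet_left join_right])
  have xe': "x \<sqinter> e \<sqsubseteq> x \<sqinter> (y \<squnion> z)" "y \<sqinter> e \<sqsubseteq> y \<sqinter> (x \<squnion> z)" "z \<sqinter> e \<sqsubseteq> z \<sqinter> (x \<squnion> y)"
    using e by (auto intro!: meet_mono)
  have xd': "x \<squnion> (y \<sqinter> z) \<sqsubseteq> x \<squnion> d" "y \<squnion> (x \<sqinter> z) \<sqsubseteq> y \<squnion> d" "z \<squnion> (x \<sqinter> y) \<sqsubseteq> z \<squnion> d"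
    using d by (auto intro!: join_mono)
  have "m x \<sqinter> m z = d" "m y \<sqinter> m z = d" "m x \<sqinter> m y = d"
    using modular_diamond_meet[OF M, of x z y d e] modular_diamond_meet[OF M, of y z x d e]
      modular_diamond_meet[OF M, of x y z d e] d de xe' xd
    by (simp_all add: m_def meet_comm[of L z] meet_comm[of L y x] join_comm[of L z] join_comm[of L y x])
  moreover have "m x \<squnion> m z = e" "m y \<squnion> m z = e" "m x \<squnion> m y = e"
    using D.modular_diamond_meet[OF MD, of x z y e d] D.modular_diamond_meet[OF MD, of y z x e d]
      D.modular_diamond_meet[OF MD, of x y z e d] d e de xe xd'
    by (simp_all add: m' meet_comm[of L z] meet_comm[of L y x] join_comm[of L z] join_comm[of L y x])
  ultimately have "d = e"
  proof -
    have "m x = m y"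
      using C unfolding cancellative_def
      by (metis m \<open>m x \<sqinter> m z = d\<close> \<open>m y \<sqinter> m z = d\<close> \<open>m x \<squnion> m z = e\<close> \<open>m y \<squnion> m z = e\<close>
          \<open>x \<in> _\<close> \<open>y \<in> _\<close> \<open>z \<in> _\<close>)
    then show ?thesis
      using \<open>m x \<sqinter> m y = d\<close> \<open>m x \<squnion> m y = e\<close>
      by (metis m join_absorb2 meet_absorb1 le_refl \<open>y \<in> _\<close>)
  qed
  have le: "x \<sqinter> (y \<squnion> z) \<sqsubseteq> (x \<sqinter> y) \<squnion> (x \<sqinter> z)"
  proof -
    have "x \<sqinter> (y \<squnion> z) \<sqsubseteq> x \<sqinter> d"
      using xe(1) \<open>d = e\<close> by simp
    also have "x \<sqinter> d = (x \<sqinter> y) \<squnion> (x \<sqinter> z)" 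
    proof -
      let ?w = "(x \<sqinter> y) \<squnion> (x \<sqinter> z)"
      have "d = ?w \<squnion> (y \<sqinter> z)"
        unfolding d_def by (simp add: weak_join_assoc[unfolded eq_is_equal] join_comm[of L "y \<sqinter> z"])
      moreover have "?w \<squnion> ((y \<sqinter> z) \<sqinter> x) = (?w \<squnion> (y \<sqinter> z)) \<sqinter> x"
        by (rule modularD[OF M]) (auto intro!: join_le meet_left)
      moreover have "(y \<sqinter> z) \<sqinter> x \<sqsubseteq> ?w"
        by (rule le_trans[OF _ join_left]) (auto intro!: meet_le meet_right intro: le_trans[OF meet_left meet_left])
      ultimately show ?thesis
        by (metis join_absorb2 join_comm meet_comm meet_closed join_closed \<open>x \<in> _\<close> \<open>y \<in> _\<close> \<open>z \<in> _\<close>)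
    qed
    finally show ?thesis by auto
  qed
  moreover have "(x \<sqinter> y) \<squnion> (x \<sqinter> z) \<sqsubseteq> x \<sqinter> (y \<squnion> z)"
    by (intro join_le meet_le) (auto intro: meet_left le_trans[OF meet_right join_left] le_trans[OF meet_right join_right])
  ultimately show "x \<sqinter> (y \<squnion> z) = (x \<sqinter> y) \<squnion> (x \<sqinter> z)"
    by (auto intro: le_antisym)
qed

text \<open>
  Both the pentagon and the diamond contain an element with two distinct complements, so this
  treats them at once. Exchanging \<open>p\<close> and \<open>r\<close>, if necessary, makes \<open>p \<sqsubseteq> r\<close> fail.
\<close>

lemma nondistributive_two_complements:
  assumes L: "lattice L" and "\<not> distributive L"
  obtains p q r where "p \<in> carrier L" "q \<in> carrier L" "r \<in> carrier L"
    "p \<sqinter>\<^bsub>L\<^esub> q = r \<sqinter>\<^bsub>L\<^esub> q" "p \<squnion>\<^bsub>L\<^esub> q = r \<squnion>\<^bsub>L\<^esub> q" "\<not> p \<sqsubseteq>\<^bsub>L\<^esub> r"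
proof -
  interpret lattice L by fact
  obtain p q r where pqr: "p \<in> carrier L" "q \<in> carrier L" "r \<in> carrier L"
    "p \<sqinter>\<^bsub>L\<^esub> q = r \<sqinter>\<^bsub>L\<^esub> q" "p \<squnion>\<^bsub>L\<^esub> q = r \<squnion>\<^bsub>L\<^esub> q" "p \<noteq> r"
    using cancellative_imp_distributive assms(2) unfolding cancellative_def by blast
  then consider "\<not> p \<sqsubseteq>\<^bsub>L\<^esub> r" | "\<not> r \<sqsubseteq>\<^bsub>L\<^esub> p" by (auto intro: le_antisym)
  then show ?thesis using that[of p q r] that[of r q p] pqr by metis
qed

section \<open>Free products of two-element chains with bounds\<close>

lemma lattice_of_order:
  assumes PO: "partial_order L"
    and J: "\<And>x y. x \<in> carrier L \<Longrightarrow> y \<in> carrier L \<Longrightarrow> J x y \<in> carrier L \<and> x \<sqsubseteq>\<^bsub>L\<^esub> J x y \<and> y \<sqsubseteq>\<^bsub>L\<^esub> J x y \<and>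
      (\<forall>u\<in>carrier L. x \<sqsubseteq>\<^bsub>L\<^esub> u \<longrightarrow> y \<sqsubseteq>\<^bsub>L\<^esub> u \<longrightarrow> J x y \<sqsubseteq>\<^bsub>L\<^esub> u)"
    and M: "\<And>x y. x \<in> carrier L \<Longrightarrow> y \<in> carrier L \<Longrightarrow> M x y \<in> carrier L \<and> M x y \<sqsubseteq>\<^bsub>L\<^esub> x \<and> M x y \<sqsubseteq>\<^bsub>L\<^esub> y \<and>
      (\<forall>u\<in>carrier L. u \<sqsubseteq>\<^bsub>L\<^esub> x \<longrightarrow> u \<sqsubseteq>\<^bsub>L\<^esub> y \<longrightarrow> u \<sqsubseteq>\<^bsub>L\<^esub> M x y)"
  shows "lattice L"
    and "x \<in> carrier L \<Longrightarrow> y \<in> carrier L \<Longrightarrow> x \<squnion>\<^bsub>L\<^esub> y = J x y"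
    and "x \<in> carrier L \<Longrightarrow> y \<in> carrier L \<Longrightarrow> x \<sqinter>\<^bsub>L\<^esub> y = M x y"
proof -
  interpret partial_order L by fact
  show "lattice L"
  proof unfold_locales
    fix x y assume xy: "x \<in> carrier L" "y \<in> carrier L"
    then show "\<exists>s. least L s (Upper L {x, y})"
      using J[OF xy] by (intro exI[of _ "J x y"] least_UpperI) (auto simp: Upper_def)
    from xy show "\<exists>s. greatest L s (Lower L {x, y})"
      using M[OF xy] by (intro exI[of _ "M x y"] greatest_LowerI) (auto simp: Lower_def)
  qed
  show "x \<in> carrier L \<Longrightarrow> y \<in> carrier L \<Longrightarrow> x \<squnion>\<^bsub>L\<^esub> y = J x y"
    using J[of x y] by (intro join_eqI) auto
  show "x \<in> carrier L \<Longrightarrow> y \<in> carrier L \<Longrightarrow> x \<sqinter>\<^bsub>L\<^esub> y = M x y"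
    using M[of x y] by (intro meet_eqI) auto
qed

text \<open>
  The free product is presented by operations on terms, but as an ordered set its joins and meets
  are determined by the order; this identifies the two.
\<close>

lemma lattice_of_algebra:
  assumes eq: "eq L = (=)"
    and le: "\<And>x y. x \<in> carrier L \<Longrightarrow> y \<in> carrier L \<Longrightarrow> x \<sqsubseteq>\<^bsub>L\<^esub> y \<longleftrightarrow> J x y = y"
    and Jc: "\<And>x y. x \<in> carrier L \<Longrightarrow> y \<in> carrier L \<Longrightarrow> J x y \<in> carrier L"
    and Mc: "\<And>x y. x \<in> carrier L \<Longrightarrow> y \<in> carrier L \<Longrightarrow> M x y \<in> carrier L"
    and Jcomm: "\<And>x y. x \<in> carrier L \<Longrightarrow> y \<in> carrier L \<Longrightarrow> J x y = J y x"
    and Mcomm: "\<And>x y. x \<in> carrier L \<Longrightarrow> y \<in> carrier L \<Longrightarrow> M x y = M y x"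
    and Jassoc: "\<And>x y z. x \<in> carrier L \<Longrightarrow> y \<in> carrier L \<Longrightarrow> z \<in> carrier L \<Longrightarrow> J (J x y) z = J x (J y z)"
    and Massoc: "\<And>x y z. x \<in> carrier L \<Longrightarrow> y \<in> carrier L \<Longrightarrow> z \<in> carrier L \<Longrightarrow> M (M x y) z = M x (M y z)"
    and JM: "\<And>x y. x \<in> carrier L \<Longrightarrow> y \<in> carrier L \<Longrightarrow> J x (M x y) = x"
    and MJ: "\<And>x y. x \<in> carrier L \<Longrightarrow> y \<in> carrier L \<Longrightarrow> M x (J x y) = x"
  shows "lattice L"
    and "x \<in> carrier L \<Longrightarrow> y \<in> carrier L \<Longrightarrow> x \<squnion>\<^bsub>L\<^esub> y = J x y"
    and "x \<in> carrier L \<Longrightarrow> y \<in> carrier L \<Longrightarrow> x \<sqinter>\<^bsub>L\<^esub> y = M x y"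
proof -
  have Jidem: "J x x = x" and Midem: "M x x = x" if "x \<in> carrier L" for x
    using JM[OF that Jc[OF that that]] MJ[OF that Mc[OF that that]] JM MJ that by auto
  have le': "x \<sqsubseteq>\<^bsub>L\<^esub> y \<longleftrightarrow> M x y = x" if "x \<in> carrier L" "y \<in> carrier L" for x y
    using le MJ JM Jcomm Mcomm that by metis
  have PO: "partial_order L"
  proof unfold_locales
    fix x y z assume "x \<in> carrier L" "y \<in> carrier L" "z \<in> carrier L" "x \<sqsubseteq>\<^bsub>L\<^esub> y" "y \<sqsubseteq>\<^bsub>L\<^esub> z"
    then show "x \<sqsubseteq>\<^bsub>L\<^esub> z" using le Jassoc by metis
  next
    fix x y assume "x \<sqsubseteq>\<^bsub>L\<^esub> y" "y \<sqsubseteq>\<^bsub>L\<^esub> x" "x \<in> carrier L" "y \<in> carrier L"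
    then show "x .=\<^bsub>L\<^esub> y" using le Jcomm eq by metis
  qed (auto simp: eq le Jidem)
  have Jlub: "J x y \<in> carrier L \<and> x \<sqsubseteq>\<^bsub>L\<^esub> J x y \<and> y \<sqsubseteq>\<^bsub>L\<^esub> J x y \<and>
      (\<forall>u\<in>carrier L. x \<sqsubseteq>\<^bsub>L\<^esub> u \<longrightarrow> y \<sqsubseteq>\<^bsub>L\<^esub> u \<longrightarrow> J x y \<sqsubseteq>\<^bsub>L\<^esub> u)" if xy: "x \<in> carrier L" "y \<in> carrier L" for x y
    using xy by (auto simp: Jc le Jassoc) (metis Jassoc Jcomm Jidem xy)+
  have Mglb: "M x y \<in> carrier L \<and> M x y \<sqsubseteq>\<^bsub>L\<^esub> x \<and> M x y \<sqsubseteq>\<^bsub>L\<^esub> y \<and>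
      (\<forall>u\<in>carrier L. u \<sqsubseteq>\<^bsub>L\<^esub> x \<longrightarrow> u \<sqsubseteq>\<^bsub>L\<^esub> y \<longrightarrow> u \<sqsubseteq>\<^bsub>L\<^esub> M x y)" if xy: "x \<in> carrier L" "y \<in> carrier L" for x y
    using xy by (auto simp: Mc le' Massoc Midem) (metis Massoc Mcomm Midem xy)+
  show "lattice L"
    and "x \<in> carrier L \<Longrightarrow> y \<in> carrier L \<Longrightarrow> x \<squnion>\<^bsub>L\<^esub> y = J x y"
    and "x \<in> carrier L \<Longrightarrow> y \<in> carrier L \<Longrightarrow> x \<sqinter>\<^bsub>L\<^esub> y = M x y"
    using lattice_of_order[OF PO, of J M, OF Jlub Mglb] by auto
qed

lemma carrier_two_chain [simp]: "carrier two_chain = UNIV"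
  by (simp add: two_chain_def)

lemma lattice_two_chain: "lattice two_chain"
  and join_two_chain [simp]: "x \<squnion>\<^bsub>two_chain\<^esub> y = (x \<or> y)"
  and meet_two_chain [simp]: "x \<sqinter>\<^bsub>two_chain\<^esub> y = (x \<and> y)"
  by (rule lattice_of_algebra[where J = "(\<or>)" and M = "(\<and>)"]; auto simp: two_chain_def)+

lemma le_two_chain [simp]: "x \<sqsubseteq>\<^bsub>two_chain\<^esub> y \<longleftrightarrow> (x \<longrightarrow> y)"
  by (auto simp: two_chain_def)

abbreviation chain_terms :: "'x set \<Rightarrow> ('x \<times> bool) lterm set" where
  "chain_terms X \<equiv> fp_terms X (\<lambda>_. two_chain)"

abbreviation chain_eq :: "lidentities \<Rightarrow> 'x set \<Rightarrow> ('x \<times> bool) lterm \<Rightarrow> ('x \<times> bool) lterm \<Rightarrow> bool" where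
  "chain_eq E X \<equiv> fp_eq E X (\<lambda>_. two_chain)"

lemma chain_terms_simps [simp]:
  "Gen v \<in> chain_terms X \<longleftrightarrow> fst v \<in> X"
  "Join p q \<in> chain_terms X \<longleftrightarrow> p \<in> chain_terms X \<and> q \<in> chain_terms X"
  "Meet p q \<in> chain_terms X \<longleftrightarrow> p \<in> chain_terms X \<and> q \<in> chain_terms X"
  by (cases v; auto simp: fp_terms_def)+

lemma chain_terms_mono: "X \<subseteq> Y \<Longrightarrow> chain_terms X \<subseteq> chain_terms Y"
  by (auto simp: fp_terms_def)

lemma chain_terms_subst: "range \<sigma> \<subseteq> chain_terms X \<Longrightarrow> lterm_subst \<sigma> p \<in> chain_terms X"
  by (induction p) auto

lemma chain_eq_terms: "chain_eq E X p q \<Longrightarrow> p \<in> chain_terms X \<and> q \<in> chain_terms X"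
  by (induction rule: fp_eq.induct) (auto simp: chain_terms_subst)

lemma equiv_chain_eq: "equiv (chain_terms X) {(p, q). chain_eq E X p q}"
  by (rule equivI) (auto simp: refl_on_def sym_def trans_def chain_eq_terms
      intro: fp_refl fp_sym fp_trans)

definition term_class :: "lidentities \<Rightarrow> 'x set \<Rightarrow> ('x \<times> bool) lterm \<Rightarrow> ('x \<times> bool) lterm set" where
  "term_class E X p = {(p, q). chain_eq E X p q} `` {p}"

definition rep :: "'a set \<Rightarrow> 'a" where
  "rep P = (SOME p. p \<in> P)"

lemma term_class_eq_iff:
  "p \<in> chain_terms X \<Longrightarrow> q \<in> chain_terms X \<Longrightarrow> term_class E X p = term_class E X q \<longleftrightarrow> chain_eq E X p q"
  unfolding term_class_def using eq_equiv_class_iff[OF equiv_chain_eq] by fastforce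

lemma chain_eq_rep:
  assumes "p \<in> chain_terms X"
  shows "chain_eq E X p (rep (term_class E X p))"
proof -
  have "p \<in> term_class E X p"
    using assms by (auto simp: term_class_def intro: fp_refl)
  then have "rep (term_class E X p) \<in> term_class E X p"
    unfolding rep_def by (rule someI)
  then show ?thesis by (simp add: term_class_def)
qed

abbreviation chains_product :: "lidentities \<Rightarrow> 'x set \<Rightarrow> ('x \<times> bool) lterm set gorder" where
  "chains_product E X \<equiv> free_product E X (\<lambda>_. two_chain)"

lemma carrier_chains_product: "carrier (chains_product E X) = term_class E X ` chain_terms X"
  by (auto simp: free_product_def quotient_def term_class_def)

lemma le_term_class:
  assumes "p \<in> chain_terms X" "q \<in> chain_terms X"
  shows "term_class E X p \<sqsubseteq>\<^bsub>chains_product E X\<^esub> term_class E X q \<longleftrightarrow> chain_eq E X (Join p q) q"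
proof
  assume "term_class E X p \<sqsubseteq>\<^bsub>chains_product E X\<^esub> term_class E X q"
  then obtain p' q' where "chain_eq E X p p'" "chain_eq E X q q'" "chain_eq E X (Join p' q') q'"
    by (auto simp: free_product_def term_class_def)
  then show "chain_eq E X (Join p q) q"
    by (meson fp_join_cong fp_sym fp_trans)
next
  assume "chain_eq E X (Join p q) q"
  with assms show "term_class E X p \<sqsubseteq>\<^bsub>chains_product E X\<^esub> term_class E X q"
    by (auto simp: free_product_def term_class_def intro: fp_refl)
qed

lemma lattice_chains_product: "lattice (chains_product E X)"
  and join_term_class: "p \<in> chain_terms X \<Longrightarrow> q \<in> chain_terms X \<Longrightarrow>
    term_class E X p \<squnion>\<^bsub>chains_product E X\<^esub> term_class E X q = term_class E X (Join p q)"
  and meet_term_class: "p \<in> chain_terms X \<Longrightarrow> q \<in> chain_terms X \<Longrightarrow>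
    term_class E X p \<sqinter>\<^bsub>chains_product E X\<^esub> term_class E X q = term_class E X (Meet p q)"
proof -
  define J where "J P Q = term_class E X (Join (rep P) (rep Q))" for P Q
  define M where "M P Q = term_class E X (Meet (rep P) (rep Q))" for P Q
  have J: "J (term_class E X p) (term_class E X q) = term_class E X (Join p q)"
    and M: "M (term_class E X p) (term_class E X q) = term_class E X (Meet p q)"
    if pq: "p \<in> chain_terms X" "q \<in> chain_terms X" for p q
  proof -
    note r = chain_eq_rep[OF pq(1), of E] chain_eq_rep[OF pq(2), of E]
    with pq show "J (term_class E X p) (term_class E X q) = term_class E X (Join p q)"
      "M (term_class E X p) (term_class E X q) = term_class E X (Meet p q)"
      unfolding J_def M_def
      by (subst term_class_eq_iff; auto dest: chain_eq_terms intro!: fp_join_cong fp_meet_cong intro: fp_sym)+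
  qed
  let ?T = "chain_terms X" and ?c = "term_class E X"
  have eqv: "?c p = ?c q" if "chain_eq E X p q" for p q
    using that chain_eq_terms[OF that] by (simp add: term_class_eq_iff)
  have ax: "?c (Join p q) = ?c (Join q p)" "?c (Meet p q) = ?c (Meet q p)"
    "?c (Join p (Meet p q)) = ?c p" "?c (Meet p (Join p q)) = ?c p"
    "?c (Join (Join p q) r) = ?c (Join p (Join q r))" "?c (Meet (Meet p q) r) = ?c (Meet p (Meet q r))"
    if "p \<in> ?T" "q \<in> ?T" "r \<in> ?T" for p q r
    using that by (intro eqv; auto intro: fp_eq.intros)+
  have *: "lattice (chains_product E X) \<and>
    (\<forall>P\<in>carrier (chains_product E X). \<forall>Q\<in>carrier (chains_product E X).
      P \<squnion>\<^bsub>chains_product E X\<^esub> Q = J P Q \<and> P \<sqinter>\<^bsub>chains_product E X\<^esub> Q = M P Q)"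
  proof (intro conjI ballI)
    have eq: "eq (chains_product E X) = (=)" by (simp add: free_product_def)
    have le: "P \<sqsubseteq>\<^bsub>chains_product E X\<^esub> Q \<longleftrightarrow> J P Q = Q"
      if "P \<in> ?c ` ?T" "Q \<in> ?c ` ?T" for P Q
      using that by (elim imageE) (simp add: J le_term_class term_class_eq_iff)
    have cl: "J P Q \<in> ?c ` ?T" "M P Q \<in> ?c ` ?T" "J P Q = J Q P" "M P Q = M Q P"
      "J P (M P Q) = P" "M P (J P Q) = P"
      if "P \<in> ?c ` ?T" "Q \<in> ?c ` ?T" for P Q
      using that ax by (elim imageE; simp add: J M)+
    have assoc: "J (J P Q) R = J P (J Q R)" "M (M P Q) R = M P (M Q R)"
      if "P \<in> ?c ` ?T" "Q \<in> ?c ` ?T" "R \<in> ?c ` ?T" for P Q R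
      using that ax by (elim imageE; simp add: J M)+
    note L = lattice_of_algebra[of "chains_product E X" J M, unfolded carrier_chains_product, OF eq le cl(1-4) assoc cl(5,6)]
    show "lattice (chains_product E X)"
      by (rule L(1))
    fix P Q assume "P \<in> carrier (chains_product E X)" "Q \<in> carrier (chains_product E X)"
    then show "P \<squnion>\<^bsub>chains_product E X\<^esub> Q = J P Q" "P \<sqinter>\<^bsub>chains_product E X\<^esub> Q = M P Q"
      by (simp_all add: L(2,3) carrier_chains_product)
  qed
  then show "lattice (chains_product E X)" by blast
  from * show "p \<in> chain_terms X \<Longrightarrow> q \<in> chain_terms X \<Longrightarrow>
    term_class E X p \<squnion>\<^bsub>chains_product E X\<^esub> term_class E X q = term_class E X (Join p q)"
    "p \<in> chain_terms X \<Longrightarrow> q \<in> chain_terms X \<Longrightarrow>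
    term_class E X p \<sqinter>\<^bsub>chains_product E X\<^esub> term_class E X q = term_class E X (Meet p q)"
    by (simp_all add: carrier_chains_product J M)
qed

fun bounded_join :: "('a \<Rightarrow> 'a \<Rightarrow> 'a) \<Rightarrow> 'a bounded \<Rightarrow> 'a bounded \<Rightarrow> 'a bounded" where
  "bounded_join f Zero y = y"
| "bounded_join f x Zero = x"
| "bounded_join f (Elem x) (Elem y) = Elem (f x y)"
| "bounded_join f x y = One"

fun bounded_meet :: "('a \<Rightarrow> 'a \<Rightarrow> 'a) \<Rightarrow> 'a bounded \<Rightarrow> 'a bounded \<Rightarrow> 'a bounded" where
  "bounded_meet f One y = y"
| "bounded_meet f x One = x"
| "bounded_meet f (Elem x) (Elem y) = Elem (f x y)"
| "bounded_meet f x y = Zero"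

lemma carrier_add_bounds: "carrier (add_bounds L) = {Zero, One} \<union> Elem ` carrier L"
  by (simp add: add_bounds_def)

lemma lattice_add_bounds:
  assumes "lattice L"
  shows "lattice (add_bounds L)"
    and "x \<in> carrier (add_bounds L) \<Longrightarrow> y \<in> carrier (add_bounds L) \<Longrightarrow>
      x \<squnion>\<^bsub>add_bounds L\<^esub> y = bounded_join (\<lambda>x y. x \<squnion>\<^bsub>L\<^esub> y) x y"
    and "x \<in> carrier (add_bounds L) \<Longrightarrow> y \<in> carrier (add_bounds L) \<Longrightarrow>
      x \<sqinter>\<^bsub>add_bounds L\<^esub> y = bounded_meet (\<lambda>x y. x \<sqinter>\<^bsub>L\<^esub> y) x y"
proof -
  interpret lattice L by fact
  have le[simp]: "x \<sqsubseteq>\<^bsub>add_bounds L\<^esub> y \<longleftrightarrow> bounded_le (\<sqsubseteq>\<^bsub>L\<^esub>) x y" for x y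
    by (simp add: add_bounds_def)
  have eq[simp]: "eq (add_bounds L) = (=)"
    by (simp add: add_bounds_def)
  have ball: "(\<forall>u\<in>carrier (add_bounds L). P u) \<longleftrightarrow> P Zero \<and> P One \<and> (\<forall>u\<in>carrier L. P (Elem u))" for P
    by (auto simp: carrier_add_bounds)
  have PO: "partial_order (add_bounds L)"
    by unfold_locales (auto simp: carrier_add_bounds intro: le_antisym le_trans)
  have J: "bounded_join (\<lambda>x y. x \<squnion>\<^bsub>L\<^esub> y) x y \<in> carrier (add_bounds L) \<and>
      x \<sqsubseteq>\<^bsub>add_bounds L\<^esub> bounded_join (\<lambda>x y. x \<squnion>\<^bsub>L\<^esub> y) x y \<and> y \<sqsubseteq>\<^bsub>add_bounds L\<^esub> bounded_join (\<lambda>x y. x \<squnion>\<^bsub>L\<^esub> y) x y \<and>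
      (\<forall>u\<in>carrier (add_bounds L). x \<sqsubseteq>\<^bsub>add_bounds L\<^esub> u \<longrightarrow> y \<sqsubseteq>\<^bsub>add_bounds L\<^esub> u \<longrightarrow>
        bounded_join (\<lambda>x y. x \<squnion>\<^bsub>L\<^esub> y) x y \<sqsubseteq>\<^bsub>add_bounds L\<^esub> u)"
    if "x \<in> carrier (add_bounds L)" "y \<in> carrier (add_bounds L)" for x y
    using that unfolding ball by (auto simp: carrier_add_bounds join_left join_right intro: join_le)
  have M: "bounded_meet (\<lambda>x y. x \<sqinter>\<^bsub>L\<^esub> y) x y \<in> carrier (add_bounds L) \<and>
      bounded_meet (\<lambda>x y. x \<sqinter>\<^bsub>L\<^esub> y) x y \<sqsubseteq>\<^bsub>add_bounds L\<^esub> x \<and> bounded_meet (\<lambda>x y. x \<sqinter>\<^bsub>L\<^esub> y) x y \<sqsubseteq>\<^bsub>add_bounds L\<^esub> y \<and>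
      (\<forall>u\<in>carrier (add_bounds L). u \<sqsubseteq>\<^bsub>add_bounds L\<^esub> x \<longrightarrow> u \<sqsubseteq>\<^bsub>add_bounds L\<^esub> y \<longrightarrow>
        u \<sqsubseteq>\<^bsub>add_bounds L\<^esub> bounded_meet (\<lambda>x y. x \<sqinter>\<^bsub>L\<^esub> y) x y)"
    if "x \<in> carrier (add_bounds L)" "y \<in> carrier (add_bounds L)" for x y
    using that unfolding ball by (auto simp: carrier_add_bounds meet_left meet_right intro: meet_le)
  note * = lattice_of_order[OF PO J M]
  show "lattice (add_bounds L)" by (rule *(1))
  show "x \<in> carrier (add_bounds L) \<Longrightarrow> y \<in> carrier (add_bounds L) \<Longrightarrow>
      x \<squnion>\<^bsub>add_bounds L\<^esub> y = bounded_join (\<lambda>x y. x \<squnion>\<^bsub>L\<^esub> y) x y" by (rule *(2))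
  show "x \<in> carrier (add_bounds L) \<Longrightarrow> y \<in> carrier (add_bounds L) \<Longrightarrow>
      x \<sqinter>\<^bsub>add_bounds L\<^esub> y = bounded_meet (\<lambda>x y. x \<sqinter>\<^bsub>L\<^esub> y) x y" by (rule *(3))
qed

lemma B_lattice_simps:
  shows "carrier (B_lattice E X) = {Zero, One} \<union> (\<lambda>p. Elem (term_class E X p)) ` chain_terms X"
    and "lattice (B_lattice E X)"
    and "x \<in> carrier (B_lattice E X) \<Longrightarrow> y \<in> carrier (B_lattice E X) \<Longrightarrow>
      x \<squnion>\<^bsub>B_lattice E X\<^esub> y = bounded_join (\<lambda>P Q. P \<squnion>\<^bsub>chains_product E X\<^esub> Q) x y"
    and "x \<in> carrier (B_lattice E X) \<Longrightarrow> y \<in> carrier (B_lattice E X) \<Longrightarrow>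
      x \<sqinter>\<^bsub>B_lattice E X\<^esub> y = bounded_meet (\<lambda>P Q. P \<sqinter>\<^bsub>chains_product E X\<^esub> Q) x y"
  unfolding B_lattice_def
  by (auto simp: carrier_add_bounds carrier_chains_product lattice_add_bounds[OF lattice_chains_product])

section \<open>Valuations in members of the variety\<close>

lemma lterm_eval_closed:
  assumes "lattice M" "range \<rho> \<subseteq> carrier M"
  shows "lterm_eval M \<rho> p \<in> carrier M"
proof -
  interpret lattice M by fact
  show ?thesis using assms(2) by (induction p) auto
qed

lemma lterm_eval_subst: "lterm_eval M \<rho> (lterm_subst \<sigma> p) = lterm_eval M (\<lambda>v. lterm_eval M \<rho> (\<sigma> v)) p"
  by (induction p) auto

text \<open>
  The universal property: a choice of elements \<open>\<rho> (i, False) \<sqsubseteq> \<rho> (i, True)\<close> in an interval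
  \<open>[z, u]\<close> of a member \<open>M\<close> of the variety extends to a homomorphism from the bounded free
  product. Its target is all of \<open>M\<close>, with the bounds sent to \<open>z\<close> and \<open>u\<close>, which avoids
  restricting \<open>M\<close> to the interval.
\<close>

locale chain_valuation = lattice M
  for E :: lidentities and M :: "('a, 'm) gorder_scheme" (structure) and z u :: 'a and \<rho> :: "'x \<times> bool \<Rightarrow> 'a" +
  assumes variety: "in_variety E M"
    and bounds_closed: "z \<in> carrier M" "u \<in> carrier M"
    and closed: "\<rho> v \<in> carrier M"
    and bounds: "z \<sqsubseteq> \<rho> v" "\<rho> v \<sqsubseteq> u"
    and mono: "\<rho> (i, False) \<sqsubseteq> \<rho> (i, True)"
begin

definition hom :: "('x \<times> bool) lterm set bounded \<Rightarrow> 'a" where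
  "hom x = (case x of Zero \<Rightarrow> z | Elem P \<Rightarrow> lterm_eval M \<rho> (rep P) | One \<Rightarrow> u)"

lemma eval_closed [simp]: "lterm_eval M \<rho> p \<in> carrier M"
  by (rule lterm_eval_closed) (use closed in \<open>auto intro: lattice_axioms\<close>)

lemma eval_bounds: "z \<sqsubseteq> lterm_eval M \<rho> p" "lterm_eval M \<rho> p \<sqsubseteq> u"
proof (induction p)
  case (Join p q)
  { case 1 show ?case
      using le_trans[OF Join(1) join_left] by (simp add: bounds_closed)
  next
    case 2 show ?case
      using Join by (simp add: bounds_closed join_le) }
next
  case (Meet p q)
  { case 1 show ?case
      using Meet by (simp add: bounds_closed meet_le)
  next
    case 2 show ?case
      using le_trans[OF meet_left Meet(2)] by (simp add: bounds_closed) }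
qed (simp_all add: bounds)

lemma eval_sound: "chain_eq E X p q \<Longrightarrow> lterm_eval M \<rho> p = lterm_eval M \<rho> q"
proof (induction rule: fp_eq.induct)
  case (fp_ident l r \<sigma>)
  have "range (\<lambda>v. lterm_eval M \<rho> (\<sigma> v)) \<subseteq> carrier M" by auto
  moreover have "\<forall>\<rho>. range \<rho> \<subseteq> carrier M \<longrightarrow> lterm_eval M \<rho> l = lterm_eval M \<rho> r"
    using fp_ident(1) variety by (auto simp: in_variety_def)
  ultimately show ?case
    unfolding lterm_eval_subst by blast
next
  case (fp_gen_join i a b)
  show ?case using mono[of i]
    by (cases a; cases b) (simp_all add: join_absorb2 closed join_comm[of _ "\<rho> (i, True)" "\<rho> (i, False)"])
next
  case (fp_gen_meet i a b)
  show ?case using mono[of i]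
    by (cases a; cases b) (simp_all add: meet_absorb1 closed meet_comm[of _ "\<rho> (i, True)" "\<rho> (i, False)"])
next
  case (fp_join_absorb p q)
  show ?case by (simp add: join_comm[of M "lterm_eval M \<rho> p" "lterm_eval M \<rho> p \<sqinter> lterm_eval M \<rho> q"] join_absorb2 meet_left)
next
  case (fp_meet_absorb p q)
  show ?case by (simp add: meet_absorb1 join_left)
next
  case (fp_join_comm p q)
  show ?case by (simp add: join_comm)
next
  case (fp_meet_comm p q)
  show ?case by (simp add: meet_comm)
qed (simp_all add: weak_join_assoc[unfolded eq_is_equal] weak_meet_assoc[unfolded eq_is_equal])

lemma hom_simps:
  "hom Zero = z" "hom One = u"
  "p \<in> chain_terms X \<Longrightarrow> hom (Elem (term_class E X p)) = lterm_eval M \<rho> p"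
  using eval_sound[OF chain_eq_rep, of p X] by (simp_all add: hom_def)

lemma hom_ops:
  assumes x: "x \<in> carrier (B_lattice E X)" and y: "y \<in> carrier (B_lattice E X)"
  shows "hom (x \<squnion>\<^bsub>B_lattice E X\<^esub> y) = hom x \<squnion> hom y"
    and "hom (x \<sqinter>\<^bsub>B_lattice E X\<^esub> y) = hom x \<sqinter> hom y"
proof -
  have bounds_ops [simp]: "z \<squnion> w = w" "w \<squnion> z = w" "z \<sqinter> w = z" "w \<sqinter> z = z"
    "u \<squnion> w = u" "w \<squnion> u = u" "u \<sqinter> w = w" "w \<sqinter> u = w"
    if "w \<in> carrier M" "z \<sqsubseteq> w" "w \<sqsubseteq> u" for w
    using that bounds_closed join_absorb2[of z w] join_absorb2[of w u] meet_absorb1[of z w] meet_absorb1[of w u]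
    by (simp_all add: join_comm[of M w z] meet_comm[of M w z] join_comm[of M u w] meet_comm[of M u w])
  have [simp]: "z \<sqsubseteq> u" using le_trans[OF bounds] bounds_closed closed by blast
  note [simp] = eval_bounds bounds_closed
  show "hom (x \<squnion>\<^bsub>B_lattice E X\<^esub> y) = hom x \<squnion> hom y"
    using x y unfolding B_lattice_simps(1) B_lattice_simps(3)[OF x y]
    by (elim UnE insertE emptyE imageE)
       (simp_all add: hom_simps join_term_class)
  show "hom (x \<sqinter>\<^bsub>B_lattice E X\<^esub> y) = hom x \<sqinter> hom y"
    using x y unfolding B_lattice_simps(1) B_lattice_simps(4)[OF x y]
    by (elim UnE insertE emptyE imageE)
       (simp_all add: hom_simps meet_term_class)
qed

definition kernel :: "'x set \<Rightarrow> (('x \<times> bool) lterm set bounded \<times> ('x \<times> bool) lterm set bounded) set" where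
  "kernel X = {(x, y). x \<in> carrier (B_lattice E X) \<and> y \<in> carrier (B_lattice E X) \<and> hom x = hom y}"

lemma congruence_kernel: "congruence (B_lattice E X) (kernel X)"
proof -
  interpret B: lattice "B_lattice E X" by (rule B_lattice_simps)
  show ?thesis
    unfolding congruence_def
    by (auto simp: kernel_def hom_ops equiv_def refl_on_def sym_def trans_def)
qed

end

section \<open>Compact congruences and the families to be refined\<close>

lemma (in lattice) congruence_full: "congruence L (carrier L \<times> carrier L)"
  unfolding congruence_def by (auto simp: equiv_def refl_on_def sym_def trans_def)

lemma cong_generated_superset: "A \<subseteq> cong_generated L A"
  by (auto simp: cong_generated_def)

lemma cong_generated_least: "congruence L \<theta> \<Longrightarrow> A \<subseteq> \<theta> \<Longrightarrow> cong_generated L A \<subseteq> \<theta>"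
  by (auto simp: cong_generated_def)

lemma congruence_ops:
  assumes "congruence L \<theta>" "(x, x') \<in> \<theta>" "(y, y') \<in> \<theta>"
  shows "(x \<squnion>\<^bsub>L\<^esub> y, x' \<squnion>\<^bsub>L\<^esub> y') \<in> \<theta>" "(x \<sqinter>\<^bsub>L\<^esub> y, x' \<sqinter>\<^bsub>L\<^esub> y') \<in> \<theta>"
proof -
  have "\<forall>v\<in>\<theta>. \<forall>w\<in>\<theta>. (fst v \<squnion>\<^bsub>L\<^esub> fst w, snd v \<squnion>\<^bsub>L\<^esub> snd w) \<in> \<theta> \<and>
      (fst v \<sqinter>\<^bsub>L\<^esub> fst w, snd v \<sqinter>\<^bsub>L\<^esub> snd w) \<in> \<theta>"
    using assms(1) by (simp add: congruence_def case_prod_beta)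
  from bspec[OF bspec[OF this assms(2)] assms(3)]
  show "(x \<squnion>\<^bsub>L\<^esub> y, x' \<squnion>\<^bsub>L\<^esub> y') \<in> \<theta>" "(x \<sqinter>\<^bsub>L\<^esub> y, x' \<sqinter>\<^bsub>L\<^esub> y') \<in> \<theta>"
    by simp_all
qed

lemma (in lattice) congruence_cong_generated:
  assumes "A \<subseteq> carrier L \<times> carrier L"
  shows "congruence L (cong_generated L A)"
  unfolding congruence_def
proof (intro conjI equivI)
  show "cong_generated L A \<subseteq> carrier L \<times> carrier L"
    by (rule cong_generated_least[OF congruence_full assms])
  have C: "congruence L \<theta> \<Longrightarrow> refl_on (carrier L) \<theta> \<and> sym \<theta> \<and> trans \<theta>" for \<theta>
    by (auto simp: congruence_def equiv_def)
  show "refl_on (carrier L) (cong_generated L A)"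
    using C unfolding cong_generated_def refl_on_def by blast
  show "sym (cong_generated L A)"
    using C unfolding cong_generated_def sym_def by blast
  show "trans (cong_generated L A)"
    using C unfolding cong_generated_def trans_def by blast
  show "\<forall>(x, x')\<in>cong_generated L A. \<forall>(y, y')\<in>cong_generated L A.
       (x \<squnion> y, x' \<squnion> y') \<in> cong_generated L A \<and> (x \<sqinter> y, x' \<sqinter> y') \<in> cong_generated L A"
  proof clarify
    fix x x' y y' assume xy: "(x, x') \<in> cong_generated L A" "(y, y') \<in> cong_generated L A"
    have "(x \<squnion> y, x' \<squnion> y') \<in> \<theta> \<and> (x \<sqinter> y, x' \<sqinter> y') \<in> \<theta>" if \<theta>: "congruence L \<theta>" "A \<subseteq> \<theta>" for \<theta>
      using congruence_ops[OF \<theta>(1)] cong_generated_least[OF \<theta>] xy by (meson subsetD)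
    then show "(x \<squnion> y, x' \<squnion> y') \<in> cong_generated L A \<and> (x \<sqinter> y, x' \<sqinter> y') \<in> cong_generated L A"
      by (simp add: cong_generated_def)
  qed
qed

lemma partial_order_Con_c: "partial_order (Con_c L)"
  by unfold_locales (auto simp: Con_c_def)

lemma le_Con_c [simp]: "x \<sqsubseteq>\<^bsub>Con_c L\<^esub> y \<longleftrightarrow> x \<subseteq> y"
  by (simp add: Con_c_def)

lemma (in lattice) cong_generated_in_Con_c:
  "finite A \<Longrightarrow> A \<subseteq> carrier L \<times> carrier L \<Longrightarrow> cong_generated L A \<in> carrier (Con_c L)"
  by (auto simp: Con_c_def)

lemma cong_generated_mono: "A \<subseteq> B \<Longrightarrow> cong_generated L A \<subseteq> cong_generated L B"
  unfolding cong_generated_def by blast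

lemma (in lattice) join_Con_c:
  assumes "finite A" "A \<subseteq> carrier L \<times> carrier L" "finite B" "B \<subseteq> carrier L \<times> carrier L"
  shows "cong_generated L A \<squnion>\<^bsub>Con_c L\<^esub> cong_generated L B = cong_generated L (A \<union> B)"
proof -
  interpret C: partial_order "Con_c L" by (rule partial_order_Con_c)
  show ?thesis
  proof (rule C.join_eqI)
    show "cong_generated L (A \<union> B) \<in> carrier (Con_c L)" 
      using assms by (intro cong_generated_in_Con_c) auto
    fix t assume "t \<in> carrier (Con_c L)"
      and AB: "cong_generated L A \<sqsubseteq>\<^bsub>Con_c L\<^esub> t" "cong_generated L B \<sqsubseteq>\<^bsub>Con_c L\<^esub> t"
    then have "congruence L t"
      by (auto simp: Con_c_def congruence_cong_generated)
    moreover have "A \<union> B \<subseteq> t"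
      using AB cong_generated_superset[of A L] cong_generated_superset[of B L] by auto
    ultimately show "cong_generated L (A \<union> B) \<sqsubseteq>\<^bsub>Con_c L\<^esub> t"
      by (simp add: cong_generated_least)
  qed (use assms in \<open>simp_all add: cong_generated_in_Con_c cong_generated_mono\<close>)
qed

lemma (in lattice) join_Con_c_closed:
  assumes "c \<in> carrier (Con_c L)" "d \<in> carrier (Con_c L)"
  shows "c \<squnion>\<^bsub>Con_c L\<^esub> d \<in> carrier (Con_c L)"
proof -
  obtain A B where AB: "finite A" "A \<subseteq> carrier L \<times> carrier L" "c = cong_generated L A"
    "finite B" "B \<subseteq> carrier L \<times> carrier L" "d = cong_generated L B"
    using assms(1,2) by (auto simp: Con_c_def)
  then show ?thesis by (simp add: join_Con_c cong_generated_in_Con_c)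
qed

text \<open>
  Unlike the least upper bound property in the semilattice of compact congruences, this allows
  \<open>\<theta>\<close> to be a congruence that is not compact, such as the kernel of a homomorphism.
\<close>

lemma (in lattice) join_Con_c_le:
  assumes "c \<in> carrier (Con_c L)" "d \<in> carrier (Con_c L)" "congruence L \<theta>" "c \<subseteq> \<theta>" "d \<subseteq> \<theta>"
  shows "c \<squnion>\<^bsub>Con_c L\<^esub> d \<subseteq> \<theta>"
proof -
  obtain A B where AB: "finite A" "A \<subseteq> carrier L \<times> carrier L" "c = cong_generated L A"
    "finite B" "B \<subseteq> carrier L \<times> carrier L" "d = cong_generated L B"
    using assms(1,2) by (auto simp: Con_c_def)
  then have "A \<union> B \<subseteq> \<theta>" using assms cong_generated_superset by blast
  then show ?thesis using AB by (simp add: join_Con_c cong_generated_least assms)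
qed

lemma B_lattice_full_congruence:
  assumes \<theta>: "congruence (B_lattice E X) \<theta>" and "(Zero, One) \<in> \<theta>"
  shows "carrier (B_lattice E X) \<times> carrier (B_lattice E X) \<subseteq> \<theta>"
proof -
  let ?B = "B_lattice E X"
  have eq: "equiv (carrier ?B) \<theta>" using \<theta> by (simp add: congruence_def)
  have "(Zero, x) \<in> \<theta>" if x: "x \<in> carrier ?B" for x
  proof -
    have xx: "(x, x) \<in> \<theta>" using eq x by (auto simp: equiv_def refl_on_def)
    \<comment> \<open>Meeting \<open>Zero \<equiv> One\<close> with \<open>x\<close> gives \<open>Zero \<equiv> x\<close>.\<close>
    have "(x \<sqinter>\<^bsub>?B\<^esub> Zero, x \<sqinter>\<^bsub>?B\<^esub> One) \<in> \<theta>"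
      by (rule congruence_ops[OF \<theta> xx assms(2)])
    then show ?thesis using x by (cases x) (auto simp: B_lattice_simps)
  qed
  then show ?thesis
    using eq by (auto simp: equiv_def) (meson symD transD)
qed

lemma top_Con_c_B_lattice:
  "\<top>\<^bsub>Con_c (B_lattice E X)\<^esub> = carrier (B_lattice E X) \<times> carrier (B_lattice E X)"
proof -
  let ?B = "B_lattice E X"
  interpret B: lattice ?B by (rule B_lattice_simps)
  interpret C: partial_order "Con_c ?B" by (rule partial_order_Con_c)
  have c: "{(Zero, One)} \<subseteq> carrier ?B \<times> carrier ?B" by (auto simp: B_lattice_simps)
  have sub: "t \<subseteq> carrier ?B \<times> carrier ?B" if "t \<in> carrier (Con_c ?B)" for t
    using that cong_generated_least[OF B.congruence_full] by (auto simp: Con_c_def)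
  have "cong_generated ?B {(Zero, One)} = carrier ?B \<times> carrier ?B"
    using B_lattice_full_congruence[OF B.congruence_cong_generated[OF c]]
      cong_generated_superset[of "{(Zero, One)}" ?B] cong_generated_least[OF B.congruence_full c] by auto
  then have "carrier ?B \<times> carrier ?B \<in> carrier (Con_c ?B)"
    using c unfolding Con_c_def by (auto intro!: exI[of _ "{(Zero, One)}"])
  then have "greatest (Con_c ?B) (carrier ?B \<times> carrier ?B) (carrier (Con_c ?B))"
    using sub by (auto simp: greatest_def)
  then show ?thesis
    unfolding top_def by (metis C.greatest_unique someI_ex)
qed

abbreviation gen :: "lidentities \<Rightarrow> 'x set \<Rightarrow> 'x \<Rightarrow> bool \<Rightarrow> ('x \<times> bool) lterm set bounded" where
  "gen E X i b \<equiv> Elem (term_class E X (Gen (i, b)))"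

text \<open>
  The families to be refined. Together these congruences identify \<open>Zero\<close> with \<open>s\<^sub>i\<close>,
  \<open>s\<^sub>i\<close> with \<open>t\<^sub>i\<close> and \<open>t\<^sub>i\<close> with \<open>One\<close>; a homomorphism kills one of them as soon as it
  maps the chain \<open>s\<^sub>i < t\<^sub>i\<close> onto the bounds, or to a point.
\<close>

definition outer_cong where
  "outer_cong E X i = cong_generated (B_lattice E X) {(Zero, gen E X i False), (gen E X i True, One)}"

definition inner_cong where
  "inner_cong E X i = cong_generated (B_lattice E X) {(gen E X i False, gen E X i True)}"

lemma gen_closed: "i \<in> X \<Longrightarrow> gen E X i b \<in> carrier (B_lattice E X)"
  by (auto simp: B_lattice_simps)

lemma Zero_One_closed: "Zero \<in> carrier (B_lattice E X)" "One \<in> carrier (B_lattice E X)"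
  by (auto simp: B_lattice_simps)

lemma outer_inner_closed:
  assumes "i \<in> X"
  shows "outer_cong E X i \<in> carrier (Con_c (B_lattice E X))"
    and "inner_cong E X i \<in> carrier (Con_c (B_lattice E X))"
proof -
  interpret B: lattice "B_lattice E X" by (rule B_lattice_simps)
  show "outer_cong E X i \<in> carrier (Con_c (B_lattice E X))"
    "inner_cong E X i \<in> carrier (Con_c (B_lattice E X))"
    unfolding outer_cong_def inner_cong_def
    using assms by (simp_all add: B.cong_generated_in_Con_c gen_closed Zero_One_closed)
qed

lemma top_le_outer_inner:
  assumes i: "i \<in> X"
  shows "\<top>\<^bsub>Con_c (B_lattice E X)\<^esub> \<subseteq> outer_cong E X i \<squnion>\<^bsub>Con_c (B_lattice E X)\<^esub> inner_cong E X i"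
proof -
  let ?A = "{(Zero, gen E X i False), (gen E X i True, One), (gen E X i False, gen E X i True)}"
  interpret B: lattice "B_lattice E X" by (rule B_lattice_simps)
  have A: "?A \<subseteq> carrier (B_lattice E X) \<times> carrier (B_lattice E X)"
    using i by (simp add: gen_closed Zero_One_closed)
  have C: "congruence (B_lattice E X) (cong_generated (B_lattice E X) ?A)"
    by (rule B.congruence_cong_generated[OF A])
  then have "trans (cong_generated (B_lattice E X) ?A)"
    by (simp add: congruence_def equiv_def)
  moreover have "(Zero, gen E X i False) \<in> cong_generated (B_lattice E X) ?A"
    "(gen E X i False, gen E X i True) \<in> cong_generated (B_lattice E X) ?A"
    "(gen E X i True, One) \<in> cong_generated (B_lattice E X) ?A"
    using cong_generated_superset[of ?A "B_lattice E X"] by auto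
  ultimately have "(Zero, One) \<in> cong_generated (B_lattice E X) ?A"
    by (meson transD)
  then have "carrier (B_lattice E X) \<times> carrier (B_lattice E X) \<subseteq> cong_generated (B_lattice E X) ?A"
    by (rule B_lattice_full_congruence[OF C])
  moreover have "outer_cong E X i \<squnion>\<^bsub>Con_c (B_lattice E X)\<^esub> inner_cong E X i = cong_generated (B_lattice E X) ?A"
    using i unfolding outer_cong_def inner_cong_def
    by (simp add: B.join_Con_c gen_closed Zero_One_closed insert_commute)
  ultimately show ?thesis by (simp add: top_Con_c_B_lattice)
qed

section \<open>Finite supports of compact congruences\<close>

text \<open>
  The sublattice generated by the chains with index in \<open>F\<close>. Classes are still taken with respect
  to \<open>X\<close>, so that this is a subset of the large lattice rather than a copy of the lattice
  over \<open>F\<close>.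
\<close>

definition B_over :: "lidentities \<Rightarrow> 'x set \<Rightarrow> 'x set \<Rightarrow> ('x \<times> bool) lterm set bounded set" where
  "B_over E X F = {Zero, One} \<union> (\<lambda>p. Elem (term_class E X p)) ` chain_terms F"

lemma carrier_B_lattice: "carrier (B_lattice E X) = B_over E X X"
  by (simp add: B_lattice_simps B_over_def)

lemma B_over_mono: "F \<subseteq> G \<Longrightarrow> B_over E X F \<subseteq> B_over E X G"
  unfolding B_over_def using chain_terms_mono by blast

lemma B_over_finite_support:
  assumes "finite S" "S \<subseteq> B_over E X X"
  obtains F where "finite F" "F \<subseteq> X" "S \<subseteq> B_over E X F"
proof -
  have "\<exists>F. finite F \<and> F \<subseteq> X \<and> S \<subseteq> B_over E X F"
    using assms
  proof (induction S rule: finite_induct)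
    case (insert x S)
    then obtain F where F: "finite F" "F \<subseteq> X" "S \<subseteq> B_over E X F" by auto
    have "\<exists>G. finite G \<and> G \<subseteq> X \<and> x \<in> B_over E X G"
    proof (cases "x \<in> {Zero, One}")
      case True
      then show ?thesis by (intro exI[of _ "{}"]) (auto simp: B_over_def)
    next
      case False
      then obtain p where p: "x = Elem (term_class E X p)" "p \<in> chain_terms X"
        using insert.prems by (auto simp: B_over_def)
      have "finite (set_lterm p)" by (induction p) auto
      moreover have "p \<in> chain_terms (fst ` set_lterm p)"
        by (force simp: fp_terms_def)
      moreover have "fst ` set_lterm p \<subseteq> X"
        using p(2) by (auto simp: fp_terms_def)
      ultimately show ?thesis
        using p(1) by (intro exI[of _ "fst ` set_lterm p"]) (simp add: B_over_def)
    qed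
    then obtain G where "finite G" "G \<subseteq> X" "x \<in> B_over E X G" by blast
    then show ?case
      using F B_over_mono[of F "F \<union> G" E X] B_over_mono[of G "F \<union> G" E X]
      by (intro exI[of _ "F \<union> G"]) auto
  qed auto
  then show ?thesis using that by blast
qed

lemma Con_c_B_lattice_support:
  assumes "c \<in> carrier (Con_c (B_lattice E X))"
  shows "\<exists>F A. finite F \<and> F \<subseteq> X \<and> finite A \<and> A \<subseteq> B_over E X F \<times> B_over E X F \<and>
    c = cong_generated (B_lattice E X) A"
proof -
  obtain A where A: "finite A" "A \<subseteq> B_over E X X \<times> B_over E X X" "c = cong_generated (B_lattice E X) A"
    using assms by (auto simp: Con_c_def carrier_B_lattice)
  have "finite (fst ` A \<union> snd ` A)" "fst ` A \<union> snd ` A \<subseteq> B_over E X X"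
    using A by auto
  then obtain F where F: "finite F" "F \<subseteq> X" "fst ` A \<union> snd ` A \<subseteq> B_over E X F"
    by (rule B_over_finite_support)
  then have "A \<subseteq> B_over E X F \<times> B_over E X F" by force
  with A F show ?thesis by blast
qed

section \<open>Free triples\<close>

lemma finite_card_of_ordLeq:
  assumes "finite S" "Card_order r" "infinite (Field r)"
  shows "|S| \<le>o r"
  using assms by (intro ordLess_imp_ordLeq finite_ordLess_infinite)
    (auto simp: card_of_well_order_on card_order_on_well_order_on Field_card_of)

lemma large_part_of_finite_cover:
  fixes J :: "nat \<Rightarrow> 'x set"
  assumes r: "Card_order r" "infinite (Field r)" and "cardSuc r \<le>o |X|" and cover: "(\<Union>u<m. J u) = X"
  shows "\<exists>u<m. cardSuc r \<le>o |J u|"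
proof (rule ccontr)
  assume no: "\<not> ?thesis"
  have "|J u| \<le>o r" if u: "u < m" for u
  proof -
    have "\<not> cardSuc r \<le>o |J u|"
      using no u by blast
    then have "|J u| <o cardSuc r"
      using r(1) by (simp add: cardSuc_Well_order card_of_Well_order not_ordLeq_iff_ordLess)
    then show ?thesis
      using r(1) by (simp add: cardSuc_ordLeq_ordLess card_of_Card_order)
  qed
  moreover have "|{..<m}| \<le>o r"
    by (rule finite_card_of_ordLeq) (use r in auto)
  ultimately have "|\<Union>u<m. J u| \<le>o r"
    using r by (intro card_of_UNION_ordLeq_infinite_Field) auto
  then show False
    using assms by (metis cardSuc_greater not_ordLess_ordLeq ordLess_ordLeq_trans)
qed

text \<open>
  The case of triples of Kuratowski's free set theorem. First \<open>k\<close> is chosen outside a set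
  \<open>A\<close> of size \<open>\<aleph>\<^sub>1\<close> and all \<open>F i j\<close> with \<open>i, j \<in> A\<close>; then \<open>j \<in> A\<close> is chosen outside
  a countably infinite \<open>N \<subseteq> A\<close> and all \<open>F i k\<close> with \<open>i \<in> N\<close>; finally \<open>i \<in> N\<close> has to avoid
  the finite set \<open>F j k\<close> only.
\<close>

lemma free_triple:
  fixes F :: "'x \<Rightarrow> 'x \<Rightarrow> 'x set"
  assumes J: "cardSuc (cardSuc natLeq) \<le>o |J|" and F: "\<And>i j. finite (F i j)"
  obtains i j k where "i \<in> J" "j \<in> J" "k \<in> J" "i \<noteq> j" "j \<noteq> k" "i \<noteq> k"
    "k \<notin> F i j" "i \<notin> F j k" "j \<notin> F i k"
proof -
  let ?w1 = "cardSuc natLeq"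
  have w1: "Card_order ?w1" "infinite (Field ?w1)"
    by (simp_all add: cardSuc_Card_order[OF natLeq_Card_order] cardSuc_finite[OF natLeq_Card_order] Field_natLeq)
  have "?w1 \<le>o |J|"
    using J w1(1) by (meson cardSuc_ordLeq ordLeq_transitive)
  then have "|Field ?w1| \<le>o |J|"
    using card_of_Field_ordIso[OF w1(1)] ordIso_ordLeq_trans by blast
  then obtain g where g: "inj_on g (Field ?w1)" "g ` Field ?w1 \<subseteq> J"
    by (auto simp: card_of_ordLeq[symmetric])
  define A where "A = g ` Field ?w1"
  have "|A| =o |Field ?w1|"
    unfolding A_def using g(1) by (meson card_of_ordIso inj_on_imp_bij_betw ordIso_symmetric)
  then have A: "|A| =o ?w1"
    using card_of_Field_ordIso[OF w1(1)] ordIso_transitive by blast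
  have AJ: "A \<subseteq> J" using g A_def by simp
  have infA: "infinite A" using w1(2) g(1) by (simp add: A_def finite_image_iff)
  have small: "|S| \<le>o |T|" if "finite S" "infinite T" for S T :: "'x set"
    by (rule finite_card_of_ordLeq) (use that in \<open>auto simp: card_of_card_order_on Field_card_of\<close>)
  have "|(\<Union>i\<in>A. \<Union>j\<in>A. insert i (F i j))| \<le>o |A|"
    using infA by (intro card_of_UNION_ordLeq_infinite ballI card_of_refl[THEN ordIso_imp_ordLeq]) (auto intro!: small simp: F)
  then have "|(\<Union>i\<in>A. \<Union>j\<in>A. insert i (F i j))| \<le>o ?w1" using A ordLeq_ordIso_trans by blast
  then have "\<not> J \<subseteq> (\<Union>i\<in>A. \<Union>j\<in>A. insert i (F i j))"
    using J w1(1) by (meson card_of_mono1 cardSuc_greater not_ordLess_ordLeq ordLeq_transitive ordLess_ordLeq_trans)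
  then obtain k where k: "k \<in> J" "k \<notin> A" "\<And>i j. i \<in> A \<Longrightarrow> j \<in> A \<Longrightarrow> k \<notin> F i j" by blast
  obtain h :: "nat \<Rightarrow> 'x" where h: "inj h" "range h \<subseteq> A"
    using infinite_countable_subset[OF infA] by auto
  define N where "N = range h"
  have N: "infinite N" "N \<subseteq> A" using h by (auto simp: N_def dest: finite_imageD)
  have "|N| \<le>o |UNIV :: nat set|" unfolding N_def by (rule card_of_image)
  then have cN: "|N| \<le>o natLeq" using card_of_nat ordLeq_ordIso_trans by blast
  have "|(\<Union>i\<in>N. insert i (F i k))| \<le>o |N|"
    using N(1) by (intro card_of_UNION_ordLeq_infinite ballI card_of_refl[THEN ordIso_imp_ordLeq]) (auto intro!: small simp: F)
  then have *: "|(\<Union>i\<in>N. insert i (F i k))| \<le>o natLeq" using cN ordLeq_transitive by blast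
  have "\<not> A \<subseteq> (\<Union>i\<in>N. insert i (F i k))"
  proof
    assume "A \<subseteq> (\<Union>i\<in>N. insert i (F i k))"
    then have "|A| \<le>o natLeq" using * by (meson card_of_mono1 ordLeq_transitive)
    then have "?w1 \<le>o natLeq" using A by (meson ordIso_ordLeq_trans ordIso_symmetric)
    then show False using cardSuc_greater[OF natLeq_Card_order] not_ordLess_ordLeq by blast
  qed
  then obtain j where j: "j \<in> A" "j \<notin> N" "\<And>i. i \<in> N \<Longrightarrow> j \<notin> F i k" by blast
  obtain i where i: "i \<in> N" "i \<notin> F j k" using N(1) F by (meson finite_subset subsetI)
  show ?thesis
    using that[of i j k] i j k N(2) AJ by blast
qed

section \<open>Evaluation in a square, and separation\<close>

context chain_valuation
begin

lemma outer_le_kernel: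
  assumes "i \<in> X" "\<rho> (i, False) = z" "\<rho> (i, True) = u"
  shows "outer_cong E X i \<subseteq> kernel X"
  unfolding outer_cong_def
  by (rule cong_generated_least[OF congruence_kernel])
     (use assms in \<open>simp add: kernel_def gen_closed Zero_One_closed hom_simps(1,2) hom_simps(3)[of _ X]\<close>)

lemma inner_le_kernel:
  assumes "i \<in> X" "\<rho> (i, False) = \<rho> (i, True)"
  shows "inner_cong E X i \<subseteq> kernel X"
  unfolding inner_cong_def
  by (rule cong_generated_least[OF congruence_kernel])
     (use assms in \<open>simp add: kernel_def gen_closed hom_simps(1,2) hom_simps(3)[of _ X]\<close>)

end

text \<open>
  A two-element sublattice of \<open>L\<close> inherits its identities, so valuations in the two-element
  chain are available for testing congruences.
\<close>

lemma two_chain_in_variety: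
  assumes L: "in_variety E L" and ab: "a \<in> carrier L" "b \<in> carrier L" "a \<sqsubseteq>\<^bsub>L\<^esub> b" "a \<noteq> b"
  shows "in_variety E two_chain"
proof -
  interpret lattice L using L by (simp add: in_variety_def)
  have ba: "b \<squnion>\<^bsub>L\<^esub> a = b" "b \<sqinter>\<^bsub>L\<^esub> a = a" "a \<squnion>\<^bsub>L\<^esub> b = b" "a \<sqinter>\<^bsub>L\<^esub> b = a"
    "a \<squnion>\<^bsub>L\<^esub> a = a" "a \<sqinter>\<^bsub>L\<^esub> a = a" "b \<squnion>\<^bsub>L\<^esub> b = b" "b \<sqinter>\<^bsub>L\<^esub> b = b"
    using ab by (simp_all add: join_absorb2 meet_absorb1 join_comm[of L b a] meet_comm[of L b a])
  have ev: "lterm_eval L (\<lambda>v. if \<rho> v then b else a) p = (if lterm_eval two_chain \<rho> p then b else a)" for \<rho> p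
    by (induction p) (auto simp: ba)
  have "lterm_eval two_chain \<rho> l = lterm_eval two_chain \<rho> r" if "(l, r) \<in> E" for l r \<rho>
  proof -
    have "range (\<lambda>v. if \<rho> v then b else a) \<subseteq> carrier L" using ab by auto
    moreover have "\<forall>\<rho>. range \<rho> \<subseteq> carrier L \<longrightarrow> lterm_eval L \<rho> l = lterm_eval L \<rho> r"
      using L that by (auto simp: in_variety_def)
    ultimately have "lterm_eval L (\<lambda>v. if \<rho> v then b else a) l = lterm_eval L (\<lambda>v. if \<rho> v then b else a) r"
      by blast
    then show ?thesis using ab(4) by (auto simp: ev split: if_splits)
  qed
  then show ?thesis by (auto simp: in_variety_def lattice_two_chain)
qed

lemma two_chain_valuation:
  assumes "in_variety E two_chain" "\<And>i. g (i, False) \<Longrightarrow> g (i, True)"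
  shows "chain_valuation E two_chain False True g"
  by (intro chain_valuation.intro chain_valuation_axioms.intro lattice_two_chain)
     (use assms in auto)

text \<open>
  The homomorphism from the square of the two-element chain to a lattice that maps the two atoms
  to \<open>p\<close> and \<open>q\<close>. As a consequence, an \<open>L\<close>-valued evaluation with generators in
  \<open>{p \<sqinter> q, p, q, p \<squnion> q}\<close> is determined by two evaluations in the two-element chain.
\<close>

definition square :: "('a, 'm) gorder_scheme \<Rightarrow> 'a \<Rightarrow> 'a \<Rightarrow> bool \<Rightarrow> bool \<Rightarrow> 'a" where
  "square L p q x y = (if x then if y then p \<squnion>\<^bsub>L\<^esub> q else p else if y then q else p \<sqinter>\<^bsub>L\<^esub> q)"

lemma square_ops:
  assumes "lattice L" "p \<in> carrier L" "q \<in> carrier L"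
  shows "square L p q x y \<squnion>\<^bsub>L\<^esub> square L p q x' y' = square L p q (x \<or> x') (y \<or> y')"
    and "square L p q x y \<sqinter>\<^bsub>L\<^esub> square L p q x' y' = square L p q (x \<and> x') (y \<and> y')"
proof -
  interpret lattice L by fact
  have le: "p \<sqsubseteq>\<^bsub>L\<^esub> p \<squnion>\<^bsub>L\<^esub> q" "q \<sqsubseteq>\<^bsub>L\<^esub> p \<squnion>\<^bsub>L\<^esub> q" "p \<sqinter>\<^bsub>L\<^esub> q \<sqsubseteq>\<^bsub>L\<^esub> p" "p \<sqinter>\<^bsub>L\<^esub> q \<sqsubseteq>\<^bsub>L\<^esub> q"
    "p \<sqinter>\<^bsub>L\<^esub> q \<sqsubseteq>\<^bsub>L\<^esub> p \<squnion>\<^bsub>L\<^esub> q"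
    using assms by (auto simp: join_left join_right meet_left meet_right intro: le_trans[OF meet_left join_left])
  have c: "p \<squnion>\<^bsub>L\<^esub> q \<in> carrier L" "p \<sqinter>\<^bsub>L\<^esub> q \<in> carrier L" using assms by auto
  have J: "a \<squnion>\<^bsub>L\<^esub> b = b" "b \<squnion>\<^bsub>L\<^esub> a = b" "a \<sqinter>\<^bsub>L\<^esub> b = a" "b \<sqinter>\<^bsub>L\<^esub> a = a"
    if "a \<sqsubseteq>\<^bsub>L\<^esub> b" "a \<in> carrier L" "b \<in> carrier L" for a b
    using that by (simp_all add: join_absorb2 meet_absorb1 join_comm[of L b a] meet_comm[of L b a])
  have s: "q \<squnion>\<^bsub>L\<^esub> p = p \<squnion>\<^bsub>L\<^esub> q" "q \<sqinter>\<^bsub>L\<^esub> p = p \<sqinter>\<^bsub>L\<^esub> q"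
    by (simp_all add: join_comm[of L q p] meet_comm[of L q p])
  show "square L p q x y \<squnion>\<^bsub>L\<^esub> square L p q x' y' = square L p q (x \<or> x') (y \<or> y')"
    using assms by (cases x; cases y; cases x'; cases y') (simp_all add: square_def J le c s)
  show "square L p q x y \<sqinter>\<^bsub>L\<^esub> square L p q x' y' = square L p q (x \<and> x') (y \<and> y')"
    using assms by (cases x; cases y; cases x'; cases y') (simp_all add: square_def J le c s)
qed

lemma lterm_eval_square:
  assumes "lattice L" "p \<in> carrier L" "q \<in> carrier L"
    and "\<And>v. v \<in> set_lterm t \<Longrightarrow> \<rho> v = square L p q (g v) (h v)"
  shows "lterm_eval L \<rho> t = square L p q (lterm_eval two_chain g t) (lterm_eval two_chain h t)"
  using assms(4) by (induction t) (simp_all add: square_ops[OF assms(1-3)])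

text \<open>
  Since \<open>p \<sqsubseteq> r\<close> fails, the elements above \<open>p\<close> and those below \<open>r\<close> form a disjoint union
  that is closed under joins and meets, and mapping the former to \<open>True\<close> and the latter to
  \<open>False\<close> is a homomorphism to the two-element chain.
\<close>

lemma lterm_eval_separation:
  assumes "lattice L" "p \<in> carrier L" "r \<in> carrier L" and pr: "\<not> p \<sqsubseteq>\<^bsub>L\<^esub> r" and \<rho>: "range \<rho> \<subseteq> carrier L"
    and "\<And>v. v \<in> set_lterm t \<Longrightarrow> if g v then p \<sqsubseteq>\<^bsub>L\<^esub> \<rho> v else \<rho> v \<sqsubseteq>\<^bsub>L\<^esub> r"
  shows "if lterm_eval two_chain g t then p \<sqsubseteq>\<^bsub>L\<^esub> lterm_eval L \<rho> t else lterm_eval L \<rho> t \<sqsubseteq>\<^bsub>L\<^esub> r"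
proof -
  interpret lattice L by fact
  note c = lterm_eval_closed[OF assms(1) \<rho>]
  show ?thesis using assms(6)
  proof (induction t)
    case (Join s t)
    let ?s = "lterm_eval L \<rho> s" and ?t = "lterm_eval L \<rho> t"
    have up: "p \<sqsubseteq>\<^bsub>L\<^esub> ?s \<squnion>\<^bsub>L\<^esub> ?t" if "p \<sqsubseteq>\<^bsub>L\<^esub> ?s \<or> p \<sqsubseteq>\<^bsub>L\<^esub> ?t"
      using that le_trans[OF _ join_left[OF c c], of p s t] le_trans[OF _ join_right[OF c c], of p t s]
      by (auto simp: assms(2) c)
    show ?case
      using Join up c assms(3)
      by (cases "lterm_eval two_chain g s"; cases "lterm_eval two_chain g t") (simp_all add: join_le)
  next
    case (Meet s t)
    let ?s = "lterm_eval L \<rho> s" and ?t = "lterm_eval L \<rho> t"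
    have down: "?s \<sqinter>\<^bsub>L\<^esub> ?t \<sqsubseteq>\<^bsub>L\<^esub> r" if "?s \<sqsubseteq>\<^bsub>L\<^esub> r \<or> ?t \<sqsubseteq>\<^bsub>L\<^esub> r"
      using that le_trans[OF meet_left[OF c c], of s r t] le_trans[OF meet_right[OF c c], of t r s]
      by (auto simp: assms(3) c)
    show ?case
      using Meet down c assms(2)
      by (cases "lterm_eval two_chain g s"; cases "lterm_eval two_chain g t") (simp_all add: meet_le)
  qed auto
qed

lemma chain_terms_set: "p \<in> chain_terms F \<Longrightarrow> v \<in> set_lterm p \<Longrightarrow> fst v \<in> F"
  by (auto simp: fp_terms_def)

text \<open>
  Why the generating pairs \<open>A\<close> of \<open>c\<^sub>i\<^sub>j\<close> are identified when \<open>s\<^sub>i, t\<^sub>i\<close> go to \<open>p, u\<close> and \<open>s\<^sub>j, t\<^sub>j\<close> to \<open>z, q\<close>, where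
  \<open>p\<close> and \<open>q\<close> are complements in \<open>[z, u]\<close>. On the support \<open>F\<close> the valuation factors through
  the square with corners \<open>z\<close>, \<open>p\<close>, \<open>q\<close>, \<open>u\<close>. The first projection of the square collapses
  both chains to points, so it kills what lies below both inner congruences; the second one
  spreads both chains from bottom to top, so it kills what lies below both outer congruences.
  A pair that both projections identify is identified by the valuation. The projections are turned
  into valuations of the whole lattice, because the two hypotheses on \<open>A\<close> are about
  congruences of the whole lattice.
\<close>

lemma (in chain_valuation) square_kernel:
  assumes two: "in_variety E two_chain" and pq: "p \<in> carrier M" "q \<in> carrier M" "z = p \<sqinter> q" "u = p \<squnion> q"
    and ij: "i \<in> X" "j \<in> X" "i \<noteq> j"
    and \<rho>: "\<And>b. \<rho> (i, b) = (if b then u else p)" "\<And>b. \<rho> (j, b) = (if b then q else z)"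
      "\<And>l b. l \<in> F \<Longrightarrow> l \<noteq> i \<Longrightarrow> l \<noteq> j \<Longrightarrow> \<rho> (l, b) = z"
    and A: "A \<subseteq> B_over E X F \<times> B_over E X F" "F \<subseteq> X"
    and outer: "A \<subseteq> outer_cong E X i \<squnion>\<^bsub>Con_c (B_lattice E X)\<^esub> outer_cong E X j"
    and inner: "A \<subseteq> inner_cong E X i \<squnion>\<^bsub>Con_c (B_lattice E X)\<^esub> inner_cong E X j"
  shows "A \<subseteq> kernel X"
proof -
  \<comment> \<open>The two projections of the square, composed with the valuation.\<close>
  define g where "g v = (fst v = i)" for v :: "'x \<times> bool"
  define h where "h v = ((fst v = i \<or> fst v = j) \<and> snd v)" for v :: "'x \<times> bool"
  interpret G: chain_valuation E two_chain False True g
    by (rule two_chain_valuation[OF two]) (auto simp: g_def)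
  interpret H: chain_valuation E two_chain False True h
    by (rule two_chain_valuation[OF two]) (auto simp: h_def)
  interpret B: lattice "B_lattice E X" by (rule B_lattice_simps)
  have "A \<subseteq> G.kernel X"
    using ij by (intro subset_trans[OF inner] B.join_Con_c_le outer_inner_closed G.congruence_kernel G.inner_le_kernel)
      (auto simp: g_def)
  moreover have "A \<subseteq> H.kernel X"
    using ij by (intro subset_trans[OF outer] B.join_Con_c_le outer_inner_closed H.congruence_kernel H.outer_le_kernel)
      (auto simp: h_def)
  moreover have "hom x = square M p q (G.hom x) (H.hom x)" if x: "x \<in> B_over E X F" for x
  proof -
    have ev: "lterm_eval M \<rho> t = square M p q (lterm_eval two_chain g t) (lterm_eval two_chain h t)"
      if t: "t \<in> chain_terms F" for t
    proof (rule lterm_eval_square[OF lattice_axioms pq(1,2)])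
      fix v assume "v \<in> set_lterm t"
      then have "fst v \<in> F" using t by (rule chain_terms_set[rotated])
      then show "\<rho> v = square M p q (g v) (h v)"
        using \<rho>(3)[of "fst v" "snd v"] \<rho>(1,2)[of "snd v"] pq(3,4) ij(3)
        by (cases v; cases "fst v = i"; cases "fst v = j") (simp_all add: g_def h_def square_def)
    qed
    have corners: "square M p q False False = z" "square M p q True True = u"
      using pq(3,4) by (simp_all add: square_def)
    show ?thesis
      using x ev chain_terms_mono[OF A(2)]
      by (auto simp: B_over_def corners hom_simps(1,2) hom_simps(3)[of _ X]
          G.hom_simps(1,2) G.hom_simps(3)[of _ X] H.hom_simps(1,2) H.hom_simps(3)[of _ X])
  qed
  ultimately show ?thesis
    using A(1) B_over_mono[OF A(2), of E X]
    by (auto simp: kernel_def G.kernel_def H.kernel_def carrier_B_lattice subset_iff)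
qed

text \<open>
  The valuation \<open>\<rho>\<close> sends \<open>s, t\<close> to \<open>p, u\<close> at \<open>i\<close>, to \<open>z, q\<close> at \<open>j\<close> and to \<open>r, u\<close> at
  \<open>k\<close>. As \<open>q\<close> is a complement of both \<open>p\<close> and \<open>r\<close>, it kills \<open>c\<^sub>1\<close> and \<open>c\<^sub>2\<close>, hence \<open>c\<^sub>3\<close>.
  The support of \<open>c\<^sub>3\<close> avoids \<open>j\<close>, so on it all values lie above \<open>p\<close> or below \<open>r\<close>, and
  \<open>c\<^sub>3\<close> is also killed by the valuation \<open>g\<close> in the two-element chain that tells these cases
  apart. But \<open>g\<close> also kills the outer congruence of \<open>k\<close> and the inner congruence of \<open>i\<close>,
  which together with \<open>c\<^sub>3\<close> give the largest congruence.
\<close>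

lemma no_refinement_on_free_triple:
  assumes E: "in_variety E L" and pqr: "p \<in> carrier L" "q \<in> carrier L" "r \<in> carrier L"
      "p \<sqinter>\<^bsub>L\<^esub> q = r \<sqinter>\<^bsub>L\<^esub> q" "p \<squnion>\<^bsub>L\<^esub> q = r \<squnion>\<^bsub>L\<^esub> q" "\<not> p \<sqsubseteq>\<^bsub>L\<^esub> r"
    and ijk: "i \<in> X" "j \<in> X" "k \<in> X" "i \<noteq> j" "j \<noteq> k" "i \<noteq> k"
    and A1: "finite A\<^sub>1" "A\<^sub>1 \<subseteq> B_over E X F\<^sub>1 \<times> B_over E X F\<^sub>1" "F\<^sub>1 \<subseteq> X" "k \<notin> F\<^sub>1"
    and A2: "finite A\<^sub>2" "A\<^sub>2 \<subseteq> B_over E X F\<^sub>2 \<times> B_over E X F\<^sub>2" "F\<^sub>2 \<subseteq> X" "i \<notin> F\<^sub>2"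
    and A3: "finite A\<^sub>3" "A\<^sub>3 \<subseteq> B_over E X F\<^sub>3 \<times> B_over E X F\<^sub>3" "F\<^sub>3 \<subseteq> X" "j \<notin> F\<^sub>3"
    and S: "S = Con_c (B_lattice E X)"
    and c: "c\<^sub>1 = cong_generated (B_lattice E X) A\<^sub>1" "c\<^sub>2 = cong_generated (B_lattice E X) A\<^sub>2"
      "c\<^sub>3 = cong_generated (B_lattice E X) A\<^sub>3"
    and i: "c\<^sub>1 \<subseteq> outer_cong E X i \<squnion>\<^bsub>S\<^esub> outer_cong E X j" "c\<^sub>1 \<subseteq> inner_cong E X i \<squnion>\<^bsub>S\<^esub> inner_cong E X j"
      "c\<^sub>2 \<subseteq> outer_cong E X j \<squnion>\<^bsub>S\<^esub> outer_cong E X k" "c\<^sub>2 \<subseteq> inner_cong E X j \<squnion>\<^bsub>S\<^esub> inner_cong E X k"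
    and ii: "\<top>\<^bsub>S\<^esub> \<subseteq> (outer_cong E X k \<squnion>\<^bsub>S\<^esub> inner_cong E X i) \<squnion>\<^bsub>S\<^esub> c\<^sub>3"
    and iii: "c\<^sub>3 \<subseteq> c\<^sub>1 \<squnion>\<^bsub>S\<^esub> c\<^sub>2"
  shows False
proof -
  interpret lattice L using E by (simp add: in_variety_def)
  interpret B: lattice "B_lattice E X" by (rule B_lattice_simps)
  define z u where "z = p \<sqinter>\<^bsub>L\<^esub> q" and "u = p \<squnion>\<^bsub>L\<^esub> q"
  have zu: "z \<in> carrier L" "u \<in> carrier L" "z \<sqsubseteq>\<^bsub>L\<^esub> u"
    "z \<sqsubseteq>\<^bsub>L\<^esub> p" "z \<sqsubseteq>\<^bsub>L\<^esub> q" "z \<sqsubseteq>\<^bsub>L\<^esub> r" "p \<sqsubseteq>\<^bsub>L\<^esub> u" "q \<sqsubseteq>\<^bsub>L\<^esub> u" "r \<sqsubseteq>\<^bsub>L\<^esub> u"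
    using pqr meet_left[of p q] join_left[of p q] meet_left[of r q] join_left[of r q]
    by (simp_all add: z_def u_def meet_left meet_right join_left join_right le_trans[OF meet_left join_left])
  have two: "in_variety E two_chain"
  proof (rule two_chain_in_variety[OF E])
    show "p \<sqinter>\<^bsub>L\<^esub> r \<noteq> p" using pqr by (metis meet_right)
  qed (use pqr in \<open>simp_all add: meet_left\<close>)
  define \<rho> where "\<rho> v = (if fst v = i then if snd v then u else p
    else if fst v = j then if snd v then q else z
    else if fst v = k then if snd v then u else r else z)" for v
  interpret V: chain_valuation E L z u \<rho>
    by unfold_locales (use E zu pqr in \<open>auto simp: \<rho>_def\<close>)
  have carrier: "A \<subseteq> carrier (B_lattice E X) \<times> carrier (B_lattice E X)"
    if "A \<subseteq> B_over E X F \<times> B_over E X F" "F \<subseteq> X" for A F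
    using that B_over_mono[of F X E X] by (auto simp: carrier_B_lattice)
  have closed: "c\<^sub>1 \<in> carrier S" "c\<^sub>2 \<in> carrier S" "c\<^sub>3 \<in> carrier S"
    unfolding c S by (simp_all add: B.cong_generated_in_Con_c A1(1) A2(1) A3(1)
        carrier[OF A1(2,3)] carrier[OF A2(2,3)] carrier[OF A3(2,3)])
  have gens: "A\<^sub>1 \<subseteq> c\<^sub>1" "A\<^sub>2 \<subseteq> c\<^sub>2" "A\<^sub>3 \<subseteq> c\<^sub>3"
    unfolding c by (rule cong_generated_superset)+
  have "A\<^sub>1 \<subseteq> V.kernel X"
  proof (rule V.square_kernel[of p q i X j F\<^sub>1])
    show "A\<^sub>1 \<subseteq> outer_cong E X i \<squnion>\<^bsub>Con_c (B_lattice E X)\<^esub> outer_cong E X j"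
      "A\<^sub>1 \<subseteq> inner_cong E X i \<squnion>\<^bsub>Con_c (B_lattice E X)\<^esub> inner_cong E X j"
      by (rule subset_trans[OF gens(1) i(1)[unfolded S]] subset_trans[OF gens(1) i(2)[unfolded S]])+
    show "\<rho> (l, b) = z" if "l \<in> F\<^sub>1" "l \<noteq> i" "l \<noteq> j" for l b
      using that A1(4) by (auto simp: \<rho>_def)
  qed (use two pqr ijk A1 in \<open>simp_all add: z_def u_def \<rho>_def\<close>)
  moreover have "A\<^sub>2 \<subseteq> V.kernel X"
  proof (rule V.square_kernel[of r q k X j F\<^sub>2])
    show "A\<^sub>2 \<subseteq> outer_cong E X k \<squnion>\<^bsub>Con_c (B_lattice E X)\<^esub> outer_cong E X j"
      "A\<^sub>2 \<subseteq> inner_cong E X k \<squnion>\<^bsub>Con_c (B_lattice E X)\<^esub> inner_cong E X j"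
      unfolding join_comm[of _ "outer_cong E X k"] join_comm[of _ "inner_cong E X k"]
      by (rule subset_trans[OF gens(2) i(3)[unfolded S]] subset_trans[OF gens(2) i(4)[unfolded S]])+
    show "\<rho> (l, b) = z" if "l \<in> F\<^sub>2" "l \<noteq> k" "l \<noteq> j" for l b
      using that A2(4) by (auto simp: \<rho>_def)
  qed (use two pqr ijk A2 in \<open>simp_all add: z_def u_def \<rho>_def\<close>)
  ultimately have "c\<^sub>1 \<squnion>\<^bsub>S\<^esub> c\<^sub>2 \<subseteq> V.kernel X"
    using closed unfolding S
    by (intro B.join_Con_c_le V.congruence_kernel) (simp_all add: c cong_generated_least V.congruence_kernel)
  with iii have "A\<^sub>3 \<subseteq> V.kernel X"
    using gens(3) by blast
  define g where "g v = (fst v = i \<or> fst v = k \<and> snd v)" for v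
  interpret G: chain_valuation E two_chain False True g
    by (rule two_chain_valuation[OF two]) (auto simp: g_def)
  have sep: "G.hom x \<longleftrightarrow> p \<sqsubseteq>\<^bsub>L\<^esub> V.hom x" if x: "x \<in> B_over E X F\<^sub>3" for x
  proof -
    have not_below: "\<not> p \<sqsubseteq>\<^bsub>L\<^esub> w" if "w \<sqsubseteq>\<^bsub>L\<^esub> r" "w \<in> carrier L" for w
      using le_trans[of p w r] that pqr by blast
    have "lterm_eval two_chain g t \<longleftrightarrow> p \<sqsubseteq>\<^bsub>L\<^esub> lterm_eval L \<rho> t" if t: "t \<in> chain_terms F\<^sub>3" for t
    proof -
      have "if lterm_eval two_chain g t then p \<sqsubseteq>\<^bsub>L\<^esub> lterm_eval L \<rho> t else lterm_eval L \<rho> t \<sqsubseteq>\<^bsub>L\<^esub> r"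
      proof (rule lterm_eval_separation)
        fix v assume "v \<in> set_lterm t"
        then have "fst v \<noteq> j" using chain_terms_set[OF t] A3(4) by blast
        then show "if g v then p \<sqsubseteq>\<^bsub>L\<^esub> \<rho> v else \<rho> v \<sqsubseteq>\<^bsub>L\<^esub> r"
          using ijk zu pqr by (auto simp: g_def \<rho>_def)
      qed (use pqr lattice_axioms V.closed in auto)
      then show ?thesis using not_below V.eval_closed by (auto split: if_splits)
    qed
    then show ?thesis
      using x zu not_below[of z] chain_terms_mono[OF A3(3)]
      by (auto simp: B_over_def V.hom_simps(1,2) V.hom_simps(3)[of _ X] G.hom_simps(1,2) G.hom_simps(3)[of _ X])
  qed
  have "A\<^sub>3 \<subseteq> G.kernel X"
  proof (rule subrelI)
    fix x y assume xy: "(x, y) \<in> A\<^sub>3"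
    then have "(x, y) \<in> V.kernel X" and "x \<in> B_over E X F\<^sub>3" "y \<in> B_over E X F\<^sub>3"
      using \<open>A\<^sub>3 \<subseteq> V.kernel X\<close> A3(2) by auto
    then show "(x, y) \<in> G.kernel X"
      by (simp add: V.kernel_def G.kernel_def sep)
  qed
  then have "c\<^sub>3 \<subseteq> G.kernel X"
    unfolding c by (rule cong_generated_least[OF G.congruence_kernel])
  moreover have "outer_cong E X k \<subseteq> G.kernel X" "inner_cong E X i \<subseteq> G.kernel X"
    by (rule G.outer_le_kernel G.inner_le_kernel; use ijk in \<open>simp add: g_def\<close>)+
  ultimately have "(outer_cong E X k \<squnion>\<^bsub>S\<^esub> inner_cong E X i) \<squnion>\<^bsub>S\<^esub> c\<^sub>3 \<subseteq> G.kernel X"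
    using closed ijk unfolding S
    by (intro B.join_Con_c_le B.join_Con_c_closed G.congruence_kernel outer_inner_closed)
  moreover have "(Zero, One) \<in> \<top>\<^bsub>S\<^esub>"
    by (simp add: S top_Con_c_B_lattice Zero_One_closed)
  ultimately have "(Zero, One) \<in> G.kernel X"
    using ii by blast
  then show False
    by (simp add: G.kernel_def G.hom_simps)
qed

text \<open>
  One of the finitely many parts \<open>J u\<close> of \<open>X\<close> has size at least \<open>\<aleph>\<^sub>2\<close>, so a free triple for
  the supports of the congruences \<open>c i j\<close> can be found inside it, where all clauses apply.
\<close>

theorem theorem3p6:
  fixes E :: lidentities and L :: "'l gorder" and X :: "'x set"
  assumes "in_variety E L" and "\<not> distributive L"
    and "cardSuc (cardSuc natLeq) \<le>o |X|"
  shows "\<not> WURP_eq (Con_c (B_lattice E X)) \<top>\<^bsub>Con_c (B_lattice E X)\<^esub>"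
proof
  define S where "S = Con_c (B_lattice E X)"
  assume "WURP_eq (Con_c (B_lattice E X)) \<top>\<^bsub>Con_c (B_lattice E X)\<^esub>"
  then have "\<exists>m>0. \<forall>(I :: 'x set) a b. a ` I \<subseteq> carrier S \<longrightarrow> b ` I \<subseteq> carrier S \<longrightarrow>
      (\<forall>i\<in>I. \<top>\<^bsub>S\<^esub> \<sqsubseteq>\<^bsub>S\<^esub> a i \<squnion>\<^bsub>S\<^esub> b i) \<longrightarrow> WURP_refines S \<top>\<^bsub>S\<^esub> m I a b"
    unfolding S_def by (rule WURP_eq_any_index)
  then obtain m where m: "\<And>(I :: 'x set) a b. a ` I \<subseteq> carrier S \<Longrightarrow> b ` I \<subseteq> carrier S \<Longrightarrow>
      (\<forall>i\<in>I. \<top>\<^bsub>S\<^esub> \<sqsubseteq>\<^bsub>S\<^esub> a i \<squnion>\<^bsub>S\<^esub> b i) \<Longrightarrow> WURP_refines S \<top>\<^bsub>S\<^esub> m I a b"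
    by blast
  have "WURP_refines S \<top>\<^bsub>S\<^esub> m X (outer_cong E X) (inner_cong E X)"
    using outer_inner_closed[of _ X E] top_le_outer_inner[of _ X E] by (intro m) (auto simp: S_def)
  then obtain J c where cover: "(\<Union>u<m. J u) = X"
    and closed: "\<forall>i\<in>X. \<forall>j\<in>X. c i j \<in> carrier S"
    and i: "\<forall>u<m. \<forall>i\<in>J u. \<forall>j\<in>J u. c i j \<sqsubseteq>\<^bsub>S\<^esub> outer_cong E X i \<squnion>\<^bsub>S\<^esub> outer_cong E X j \<and>
      c i j \<sqsubseteq>\<^bsub>S\<^esub> inner_cong E X i \<squnion>\<^bsub>S\<^esub> inner_cong E X j"
    and ii: "\<forall>u<m. \<forall>i\<in>J u. \<forall>j\<in>J u.
      \<top>\<^bsub>S\<^esub> \<sqsubseteq>\<^bsub>S\<^esub> (outer_cong E X j \<squnion>\<^bsub>S\<^esub> inner_cong E X i) \<squnion>\<^bsub>S\<^esub> c i j"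
    and iii: "\<forall>i\<in>X. \<forall>j\<in>X. \<forall>k\<in>X. c i k \<sqsubseteq>\<^bsub>S\<^esub> c i j \<squnion>\<^bsub>S\<^esub> c j k"
    unfolding WURP_refines_def by (elim exE conjE) (rule that)
  obtain u where u: "u < m" "cardSuc (cardSuc natLeq) \<le>o |J u|"
  proof -
    have "\<exists>u<m. cardSuc (cardSuc natLeq) \<le>o |J u|"
      by (rule large_part_of_finite_cover[OF _ _ assms(3) cover])
        (simp_all add: cardSuc_Card_order[OF natLeq_Card_order] cardSuc_finite[OF natLeq_Card_order] Field_natLeq)
    then show ?thesis using that by blast
  qed
  then have Ju: "J u \<subseteq> X" using cover by blast
  define F where "F i j = (SOME F. finite F \<and> F \<subseteq> X \<and> (\<exists>A. finite A \<and>
      A \<subseteq> B_over E X F \<times> B_over E X F \<and> c i j = cong_generated (B_lattice E X) A))" for i j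
  have F: "finite (F i j) \<and> F i j \<subseteq> X \<and> (\<exists>A. finite A \<and>
      A \<subseteq> B_over E X (F i j) \<times> B_over E X (F i j) \<and> c i j = cong_generated (B_lattice E X) A)"
    if "i \<in> X" "j \<in> X" for i j
    unfolding F_def
  proof (rule someI_ex)
    show "\<exists>F. finite F \<and> F \<subseteq> X \<and> (\<exists>A. finite A \<and>
      A \<subseteq> B_over E X F \<times> B_over E X F \<and> c i j = cong_generated (B_lattice E X) A)"
      using Con_c_B_lattice_support[of "c i j" E X] closed that unfolding S_def by blast
  qed
  \<comment> \<open>Supports are meaningful only for indices in \<open>X\<close>; elsewhere any finite set serves for the free triple.\<close>
  define G where "G i j = (if i \<in> X \<and> j \<in> X then F i j else {})" for i j
  have "\<And>i j. finite (G i j)"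
    using F by (simp add: G_def)
  from free_triple[OF u(2) this] obtain i j k
    where ijk: "i \<in> J u" "j \<in> J u" "k \<in> J u" "i \<noteq> j" "j \<noteq> k" "i \<noteq> k"
      and freeG: "k \<notin> G i j" "i \<notin> G j k" "j \<notin> G i k" .
  have X: "i \<in> X" "j \<in> X" "k \<in> X" using ijk Ju by auto
  have free: "k \<notin> F i j" "i \<notin> F j k" "j \<notin> F i k"
    using freeG X by (simp_all add: G_def)
  obtain A\<^sub>1 where A1: "finite A\<^sub>1" "A\<^sub>1 \<subseteq> B_over E X (F i j) \<times> B_over E X (F i j)"
    "c i j = cong_generated (B_lattice E X) A\<^sub>1" "F i j \<subseteq> X"
    using F[OF X(1,2)] by blast
  obtain A\<^sub>2 where A2: "finite A\<^sub>2" "A\<^sub>2 \<subseteq> B_over E X (F j k) \<times> B_over E X (F j k)"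
    "c j k = cong_generated (B_lattice E X) A\<^sub>2" "F j k \<subseteq> X"
    using F[OF X(2,3)] by blast
  obtain A\<^sub>3 where A3: "finite A\<^sub>3" "A\<^sub>3 \<subseteq> B_over E X (F i k) \<times> B_over E X (F i k)"
    "c i k = cong_generated (B_lattice E X) A\<^sub>3" "F i k \<subseteq> X"
    using F[OF X(1,3)] by blast
  have "lattice L" using assms(1) by (simp add: in_variety_def)
  then obtain p q r where pqr: "p \<in> carrier L" "q \<in> carrier L" "r \<in> carrier L"
    "p \<sqinter>\<^bsub>L\<^esub> q = r \<sqinter>\<^bsub>L\<^esub> q" "p \<squnion>\<^bsub>L\<^esub> q = r \<squnion>\<^bsub>L\<^esub> q" "\<not> p \<sqsubseteq>\<^bsub>L\<^esub> r"
    using assms(2) by (rule nondistributive_two_complements)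
  have S_le: "x \<sqsubseteq>\<^bsub>S\<^esub> y \<longleftrightarrow> x \<subseteq> y" for x y by (simp add: S_def)
  show False
  proof (rule no_refinement_on_free_triple[OF assms(1) pqr X ijk(4-6) A1(1,2,4) free(1)
        A2(1,2,4) free(2) A3(1,2,4) free(3) S_def A1(3) A2(3) A3(3)])
    show "c i j \<subseteq> outer_cong E X i \<squnion>\<^bsub>S\<^esub> outer_cong E X j" "c i j \<subseteq> inner_cong E X i \<squnion>\<^bsub>S\<^esub> inner_cong E X j"
      "c j k \<subseteq> outer_cong E X j \<squnion>\<^bsub>S\<^esub> outer_cong E X k" "c j k \<subseteq> inner_cong E X j \<squnion>\<^bsub>S\<^esub> inner_cong E X k"
      using i ijk(1-3) u(1) by (simp_all add: S_le)
    show "\<top>\<^bsub>S\<^esub> \<subseteq> (outer_cong E X k \<squnion>\<^bsub>S\<^esub> inner_cong E X i) \<squnion>\<^bsub>S\<^esub> c i k"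
      using ii ijk(1-3) u(1) by (simp add: S_le)
    show "c i k \<subseteq> c i j \<squnion>\<^bsub>S\<^esub> c j k"
      using iii X by (simp add: S_le)
  qed
qed

end
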